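(* There is an isomorphism of operads $$\varphi:\mathcal{C}om\mathcal{T}riass\xrightarrow{\ \cong\ }\mathbb G$$ determined by $\varphi(\nu)=d_1$ and $\varphi(\mu)=B$, where $d_1$ is the $2$-player dictator game and $B$ is the $2$-player bargaining game. Its inverse is given by the Möbius transform: for every $n\ge1$ and every $v\in\mathbb G(n)$, $$\varphi^{-1}(v)=\sum_{\emptyset\ne S\subseteq[n]}\mu^v(S)\,e_S,$$ where $\{e_S\}_{\emptyset\neq S\subseteq[n]}$ is the basis of $\mathcal{C}om\mathcal{T}riass(n)$ described in the context and $\mu^v$ is the Möbius transform of $v$.
   Context: Operads are symmetric operads in real vector spaces, given by left $\mathbb S_n$-modules, bilinear partial compositions $\circ_i$ and a unit. Operad of games: $\mathbb G(n)$ is the vector space of functions $v:\mathcal P([n])\to\mathbb R$ with $v(\emptyset)=0$ ("$n$-player games"), with $(\sigma\star v)(S)=v(\sigma^{-1}(S))$. For $\alpha$ on the ordered player set $A$, $\beta$ on the ordered player set $B$ (disjoint), $i\in A$, the game $\alpha\circ_i\beta$ has player set $A\diamond_iB=(A\setminus\{i\})\cup B$ (with $B$ inserted in order in the place of $i$) and $$(\alpha\circ_i\beta)(S)=\beta(B)\alpha(S\cap A)+\partial_i\alpha(S\cap A)\,\beta(S\cap B),\qquad \partial_i\alpha(T)=\alpha(T\cup\{i\})-\alpha(T\setminus\{i\}).$$ The unit is the $1$-player game with value $1$. With these data $\mathbb G$ is an operad. The game $d_1\in\mathbb G(2)$ is $d_1(S)=1$ if $1\in S$ and $0$ otherwise;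 $B\in\mathbb G(2)$ is $B(\{1,2\})=1$ and $0$ on all other subsets. The Möbius transform of $v$ is $\mu^v(S)=\sum_{T\subseteq S}(-1)^{|S\setminus T|}v(T)$. $\mathcal{C}om\mathcal{T}riass$ is the operad generated by two arity $2$ operations: $\nu$, with no symmetry (generating the regular representation of $\mathbb S_2$), and $\mu$, symmetric (generating the trivial representation), subject to the relations (1) $\mu\circ_1\mu=\mu\circ_2\mu$; (2) $\nu\circ_1\nu=\nu\circ_2\nu=\nu\circ_2((21)\star\nu)$; (3) $\nu\circ_2\mu=\nu\circ_2\nu$; (4) $\nu\circ_1\mu=\mu\circ_2\nu$; i.e. it is the free operad on these generators modulo the operadic ideal generated by these relations. Elements $e_S$: put $\mu^{(1)}=\mathrm{id}$, $\mu^{(k+1)}=\mu\circ_1\mu^{(k)}$; for $1\le k\le n$ let $e_{[k],k}=\mu^{(k)}$ and $e_{[k],n+1}=\nu\circ_1e_{[k],n}$. For $S\subseteq[n]$ with $|S|=k\ge1$, let $\sigma\in\mathbb S_n$ be the permutation mapping $[k]$ increasingly onto $S$ and $\{k+1,\dots,n\}$ increasingly onto $[n]\setminus S$, and put $e_S=\sigma\star e_{[k],n}\in\mathcal{C}om\mathcal{T}riass(n)$. *)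

theory Defs
  imports
    Complex_Main
    "HOL-Algebra.Module"
    "HOL-Algebra.AbelCoset"
    "HOL-Combinatorics.Permutations"
    "HOL-Library.Uprod"
    "HOL-Library.Poly_Mapping"
begin

section \<open>Real vector spaces with explicit carriers\<close>

definition real_ring :: "real ring" where
  "real_ring = \<lparr>carrier = UNIV, monoid.mult = (*), one = 1, ring.zero = 0, add = (+)\<rparr>"

abbreviation vec_space :: "(real, 'a) module \<Rightarrow> bool" where
  "vec_space V \<equiv> module real_ring V"

definition lin_map :: "(real, 'a) module \<Rightarrow> (real, 'b) module \<Rightarrow> ('a \<Rightarrow> 'b) \<Rightarrow> bool" where
  "lin_map V W f \<longleftrightarrow>
     f \<in> carrier V \<rightarrow> carrier W \<and>
     (\<forall>x\<in>carrier V. \<forall>y\<in>carrier V. f (x \<oplus>\<^bsub>V\<^esub> y) = f x \<oplus>\<^bsub>W\<^esub> f y) \<and>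
     (\<forall>r. \<forall>x\<in>carrier V. f (r \<odot>\<^bsub>V\<^esub> x) = r \<odot>\<^bsub>W\<^esub> f x)"

text \<open>A finite family \<open>(b j)\<close>, \<open>j \<in> J\<close>, that is linearly independent and spans.\<close>

definition finite_basis :: "(real, 'a) module \<Rightarrow> 'j set \<Rightarrow> ('j \<Rightarrow> 'a) \<Rightarrow> bool" where
  "finite_basis V J b \<longleftrightarrow>
     finite J \<and> b \<in> J \<rightarrow> carrier V \<and>
     (\<forall>c. (\<Oplus>\<^bsub>V\<^esub>j\<in>J. c j \<odot>\<^bsub>V\<^esub> b j) = \<zero>\<^bsub>V\<^esub> \<longrightarrow> (\<forall>j\<in>J. c j = 0)) \<and>
     (\<forall>x\<in>carrier V. \<exists>c. x = (\<Oplus>\<^bsub>V\<^esub>j\<in>J. c j \<odot>\<^bsub>V\<^esub> b j))"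


section \<open>Symmetric operads\<close>

text \<open>
  \<open>pcomp P m n i x y\<close> is the partial composition \<open>x \<circ>\<^sub>i y\<close> of \<open>x\<close> of arity \<open>m\<close> and \<open>y\<close> of
  arity \<open>n\<close>; \<open>act P n \<sigma> x\<close> is \<open>\<sigma> \<star> x\<close>. Permutations of \<open>[n]\<close> are functions \<open>\<sigma>\<close> on the naturals
  with \<open>\<sigma> permutes {1..n}\<close>.
\<close>

record 'a operad =
  component :: "nat \<Rightarrow> (real, 'a) module"
  act :: "nat \<Rightarrow> (nat \<Rightarrow> nat) \<Rightarrow> 'a \<Rightarrow> 'a"
  pcomp :: "nat \<Rightarrow> nat \<Rightarrow> nat \<Rightarrow> 'a \<Rightarrow> 'a \<Rightarrow> 'a"
  opunit :: 'a

abbreviation elts :: "'a operad \<Rightarrow> nat \<Rightarrow> 'a set" where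
  "elts P n \<equiv> carrier (component P n)"

text \<open>
  When an object with inputs \<open>[n]\<close> is inserted in order in place of input \<open>i\<close> of another one, the
  inputs are renumbered consecutively: input \<open>k\<close> of the inserted object becomes \<open>inner_pos i k\<close>, and
  an input \<open>j \<noteq> i\<close> of the outer object becomes \<open>outer_pos n i j\<close>.
\<close>

definition inner_pos :: "nat \<Rightarrow> nat \<Rightarrow> nat" where
  "inner_pos i k = i + k - 1"

definition outer_pos :: "nat \<Rightarrow> nat \<Rightarrow> nat \<Rightarrow> nat" where
  "outer_pos n i j = (if j < i then j else j + n - 1)"

text \<open>
  The permutation \<open>\<sigma> \<circ>\<^sub>i \<tau>\<close> for which
  \<open>(\<sigma> \<star> x) \<circ>\<^bsub>\<sigma> i\<^esub> (\<tau> \<star> y) = (\<sigma> \<circ>\<^sub>i \<tau>) \<star> (x \<circ>\<^sub>i y)\<close>, where \<open>y\<close> has arity \<open>n\<close>: it sends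
  \<open>inner_pos i k\<close> to \<open>inner_pos (\<sigma> i) (\<tau> k)\<close> and \<open>outer_pos n i j\<close> to \<open>outer_pos n (\<sigma> i) (\<sigma> j)\<close>.
\<close>

definition perm_pcomp :: "nat \<Rightarrow> nat \<Rightarrow> (nat \<Rightarrow> nat) \<Rightarrow> (nat \<Rightarrow> nat) \<Rightarrow> nat \<Rightarrow> nat" where
  "perm_pcomp n i \<sigma> \<tau> p =
     (if p < i then outer_pos n (\<sigma> i) (\<sigma> p)
      else if p < i + n then inner_pos (\<sigma> i) (\<tau> (p + 1 - i))
      else outer_pos n (\<sigma> i) (\<sigma> (p + 1 - n)))"

locale operad =
  fixes P :: "'a operad"
  assumes vec_space_component: "vec_space (component P n)"
    and act_lin: "\<sigma> permutes {1..n} \<Longrightarrow> lin_map (component P n) (component P n) (act P n \<sigma>)"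
    and act_id: "x \<in> elts P n \<Longrightarrow> act P n id x = x"
    and act_comp:
      "\<lbrakk>\<sigma> permutes {1..n}; \<tau> permutes {1..n}; x \<in> elts P n\<rbrakk>
        \<Longrightarrow> act P n (\<sigma> \<circ> \<tau>) x = act P n \<sigma> (act P n \<tau> x)"
    and pcomp_lin_left:
      "\<lbrakk>i \<in> {1..m}; y \<in> elts P n\<rbrakk>
        \<Longrightarrow> lin_map (component P m) (component P (m + n - 1)) (\<lambda>x. pcomp P m n i x y)"
    and pcomp_lin_right:
      "\<lbrakk>i \<in> {1..m}; x \<in> elts P m\<rbrakk>
        \<Longrightarrow> lin_map (component P n) (component P (m + n - 1)) (pcomp P m n i x)"
    and pcomp_sequential:
      "\<lbrakk>i \<in> {1..l}; j \<in> {1..m}; x \<in> elts P l; y \<in> elts P m; z \<in> elts P n\<rbrakk>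
        \<Longrightarrow> pcomp P (l + m - 1) n (i + j - 1) (pcomp P l m i x y) z
          = pcomp P l (m + n - 1) i x (pcomp P m n j y z)"
    and pcomp_parallel:
      "\<lbrakk>i \<in> {1..l}; k \<in> {1..l}; i < k; x \<in> elts P l; y \<in> elts P m; z \<in> elts P n\<rbrakk>
        \<Longrightarrow> pcomp P (l + m - 1) n (k + m - 1) (pcomp P l m i x y) z
          = pcomp P (l + n - 1) m i (pcomp P l n k x z) y"
    and opunit_closed: "opunit P \<in> elts P 1"
    and opunit_left: "x \<in> elts P n \<Longrightarrow> pcomp P 1 n 1 (opunit P) x = x"
    and opunit_right: "\<lbrakk>i \<in> {1..n}; x \<in> elts P n\<rbrakk> \<Longrightarrow> pcomp P n 1 i x (opunit P) = x"
    and pcomp_equivariant: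
      "\<lbrakk>i \<in> {1..m}; \<sigma> permutes {1..m}; \<tau> permutes {1..n}; x \<in> elts P m; y \<in> elts P n\<rbrakk>
        \<Longrightarrow> pcomp P m n (\<sigma> i) (act P m \<sigma> x) (act P n \<tau> y)
          = act P (m + n - 1) (perm_pcomp n i \<sigma> \<tau>) (pcomp P m n i x y)"

locale operad_hom = dom: operad P + cod: operad Q
  for P :: "'a operad" and Q :: "'b operad" +
  fixes \<phi> :: "nat \<Rightarrow> 'a \<Rightarrow> 'b"
  assumes hom_lin: "lin_map (component P n) (component Q n) (\<phi> n)"
    and hom_act:
      "\<lbrakk>\<sigma> permutes {1..n}; x \<in> elts P n\<rbrakk> \<Longrightarrow> \<phi> n (act P n \<sigma> x) = act Q n \<sigma> (\<phi> n x)"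
    and hom_pcomp:
      "\<lbrakk>i \<in> {1..m}; x \<in> elts P m; y \<in> elts P n\<rbrakk>
        \<Longrightarrow> \<phi> (m + n - 1) (pcomp P m n i x y) = pcomp Q m n i (\<phi> m x) (\<phi> n y)"
    and hom_opunit: "\<phi> 1 (opunit P) = opunit Q"

locale operad_iso = operad_hom +
  assumes iso_bij: "bij_betw (\<phi> n) (elts P n) (elts Q n)"


section \<open>Operadic ideals and quotients\<close>

definition operadic_ideal :: "'a operad \<Rightarrow> (nat \<Rightarrow> 'a set) \<Rightarrow> bool" where
  "operadic_ideal P I \<longleftrightarrow>
     (\<forall>n. submodule (I n) real_ring (component P n)) \<and>
     (\<forall>n \<sigma>. \<sigma> permutes {1..n} \<longrightarrow> (\<forall>x\<in>I n. act P n \<sigma> x \<in> I n)) \<and>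
     (\<forall>m n. \<forall>i\<in>{1..m}. \<forall>x\<in>I m. \<forall>y\<in>elts P n. pcomp P m n i x y \<in> I (m + n - 1)) \<and>
     (\<forall>m n. \<forall>i\<in>{1..m}. \<forall>x\<in>elts P m. \<forall>y\<in>I n. pcomp P m n i x y \<in> I (m + n - 1))"

definition ideal_generated :: "'a operad \<Rightarrow> (nat \<Rightarrow> 'a set) \<Rightarrow> nat \<Rightarrow> 'a set" where
  "ideal_generated P R n = \<Inter>{I n | I. operadic_ideal P I \<and> (\<forall>k. R k \<subseteq> I k)}"

definition quot_space :: "(real, 'a) module \<Rightarrow> 'a set \<Rightarrow> (real, 'a set) module" where
  "quot_space V W =
     \<lparr>carrier = a_rcosets\<^bsub>V\<^esub> W, monoid.mult = undefined, one = undefined,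
      ring.zero = W, add = (<+>\<^bsub>V\<^esub>),
      smult = (\<lambda>r X. \<Union>x\<in>X. W +>\<^bsub>V\<^esub> (r \<odot>\<^bsub>V\<^esub> x))\<rparr>"

definition quot_operad :: "'a operad \<Rightarrow> (nat \<Rightarrow> 'a set) \<Rightarrow> 'a set operad" where
  "quot_operad P I =
     \<lparr>component = (\<lambda>n. quot_space (component P n) (I n)),
      act = (\<lambda>n \<sigma> X. \<Union>x\<in>X. I n +>\<^bsub>component P n\<^esub> act P n \<sigma> x),
      pcomp = (\<lambda>m n i X Y. \<Union>x\<in>X. \<Union>y\<in>Y.
        I (m + n - 1) +>\<^bsub>component P (m + n - 1)\<^esub> pcomp P m n i x y),
      opunit = I 1 +>\<^bsub>component P 1\<^esub> opunit P\<rparr>"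


section \<open>The free operad on a binary generator without symmetry and a symmetric one\<close>

text \<open>
  The component of arity \<open>n\<close> has as basis the trees whose leaves are labelled bijectively by \<open>[n]\<close>
  and whose vertices carry a basis element of the generating \<open>S\<^sub>2\<close>-modules. For the regular
  representation, spanned by \<open>\<nu>\<close> and \<open>(21) \<star> \<nu>\<close>, such a vertex amounts to an ordered pair of
  subtrees (\<open>Nu\<close>); for the trivial one to an unordered pair (\<open>Mu\<close>).
\<close>

datatype 'l gen_tree =
    Leaf 'l
  | Nu "'l gen_tree" "'l gen_tree"
  | Mu "'l gen_tree uprod"

inductive linear_tree :: "'l gen_tree \<Rightarrow> bool" where
  "linear_tree (Leaf a)"
| "\<lbrakk>linear_tree s; linear_tree t; set_gen_tree s \<inter> set_gen_tree t = {}\<rbrakk>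
    \<Longrightarrow> linear_tree (Nu s t)"
| "\<lbrakk>linear_tree s; linear_tree t; set_gen_tree s \<inter> set_gen_tree t = {}\<rbrakk>
    \<Longrightarrow> linear_tree (Mu (Upair s t))"

definition trees :: "nat \<Rightarrow> nat gen_tree set" where
  "trees n = {t. linear_tree t \<and> set_gen_tree t = {1..n}}"

primrec subst_tree :: "('l \<Rightarrow> 'k gen_tree) \<Rightarrow> 'l gen_tree \<Rightarrow> 'k gen_tree" where
  "subst_tree h (Leaf a) = h a"
| "subst_tree h (Nu s t) = Nu (subst_tree h s) (subst_tree h t)"
| "subst_tree h (Mu u) = Mu (map_uprod (subst_tree h) u)"

definition graft :: "nat \<Rightarrow> nat \<Rightarrow> nat gen_tree \<Rightarrow> nat gen_tree \<Rightarrow> nat gen_tree" where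
  "graft n i s t =
     subst_tree (\<lambda>j. if j = i then map_gen_tree (inner_pos i) t else Leaf (outer_pos n i j)) s"

definition free_operad :: "(nat gen_tree \<Rightarrow>\<^sub>0 real) operad" where
  "free_operad =
     \<lparr>component = (\<lambda>n.
        \<lparr>carrier = {f. Poly_Mapping.keys f \<subseteq> trees n},
         monoid.mult = undefined, one = undefined, ring.zero = 0, add = (+),
         smult = (\<lambda>r. Poly_Mapping.map ((*) r))\<rparr>),
      act = (\<lambda>n \<sigma> f. \<Sum>t\<in>Poly_Mapping.keys f.
        Poly_Mapping.single (map_gen_tree \<sigma> t) (Poly_Mapping.lookup f t)),
      pcomp = (\<lambda>m n i f g. \<Sum>s\<in>Poly_Mapping.keys f. \<Sum>t\<in>Poly_Mapping.keys g.
        Poly_Mapping.single (graft n i s t) (Poly_Mapping.lookup f s * Poly_Mapping.lookup g t)),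
      opunit = Poly_Mapping.single (Leaf 1) 1\<rparr>"


section \<open>The operad ComTriass\<close>

definition free_nu :: "nat gen_tree \<Rightarrow>\<^sub>0 real" where
  "free_nu = Poly_Mapping.single (Nu (Leaf 1) (Leaf 2)) 1"

definition free_mu :: "nat gen_tree \<Rightarrow>\<^sub>0 real" where
  "free_mu = Poly_Mapping.single (Mu (Upair (Leaf 1) (Leaf 2))) 1"

definition com_triass_relators :: "nat \<Rightarrow> (nat gen_tree \<Rightarrow>\<^sub>0 real) set" where
  "com_triass_relators n =
     (let \<nu> = free_nu; \<mu> = free_mu;
          \<nu>' = act free_operad 2 (transpose 1 2) free_nu;
          c = pcomp free_operad 2 2
      in if n = 3 then
           {c 1 \<mu> \<mu> - c 2 \<mu> \<mu>,
            c 1 \<nu> \<nu> - c 2 \<nu> \<nu>, c 2 \<nu> \<nu> - c 2 \<nu> \<nu>',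
            c 2 \<nu> \<mu> - c 2 \<nu> \<nu>,
            c 1 \<nu> \<mu> - c 2 \<mu> \<nu>}
         else {})"

definition com_triass_ideal :: "nat \<Rightarrow> (nat gen_tree \<Rightarrow>\<^sub>0 real) set" where
  "com_triass_ideal = ideal_generated free_operad com_triass_relators"

definition com_triass :: "(nat gen_tree \<Rightarrow>\<^sub>0 real) set operad" where
  "com_triass = quot_operad free_operad com_triass_ideal"

definition ct_nu :: "(nat gen_tree \<Rightarrow>\<^sub>0 real) set" where
  "ct_nu = com_triass_ideal 2 +>\<^bsub>component free_operad 2\<^esub> free_nu"

definition ct_mu :: "(nat gen_tree \<Rightarrow>\<^sub>0 real) set" where
  "ct_mu = com_triass_ideal 2 +>\<^bsub>component free_operad 2\<^esub> free_mu"


section \<open>The elements \<open>e\<^sub>S\<close>\<close>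

text \<open>\<open>mu_power k\<close> is \<open>\<mu>\<^sup>(\<^sup>k\<^sup>)\<close> for \<open>k \<ge> 1\<close>; the value at \<open>0\<close> plays no role.\<close>

fun mu_power :: "nat \<Rightarrow> (nat gen_tree \<Rightarrow>\<^sub>0 real) set" where
  "mu_power 0 = undefined"
| "mu_power (Suc 0) = opunit com_triass"
| "mu_power (Suc (Suc k)) = pcomp com_triass 2 (Suc k) 1 ct_mu (mu_power (Suc k))"

text \<open>\<open>e_initial k d\<close> is the element indexed by \<open>[k]\<close> in arity \<open>k + d\<close>.\<close>

primrec e_initial :: "nat \<Rightarrow> nat \<Rightarrow> (nat gen_tree \<Rightarrow>\<^sub>0 real) set" where
  "e_initial k 0 = mu_power k"
| "e_initial k (Suc d) = pcomp com_triass 2 (k + d) 1 ct_nu (e_initial k d)"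

definition is_unshuffle :: "nat \<Rightarrow> nat set \<Rightarrow> (nat \<Rightarrow> nat) \<Rightarrow> bool" where
  "is_unshuffle n S \<sigma> \<longleftrightarrow>
     \<sigma> permutes {1..n} \<and>
     \<sigma> ` {1..card S} = S \<and> strict_mono_on {1..card S} \<sigma> \<and>
     \<sigma> ` {card S + 1..n} = {1..n} - S \<and> strict_mono_on {card S + 1..n} \<sigma>"

definition unshuffle :: "nat \<Rightarrow> nat set \<Rightarrow> nat \<Rightarrow> nat" where
  "unshuffle n S = (THE \<sigma>. is_unshuffle n S \<sigma>)"

lemma strict_mono_on_image_unique:
  fixes f g :: "nat \<Rightarrow> nat"
  assumes f: "strict_mono_on A f" and g: "strict_mono_on A g"
    and im: "f ` A = g ` A" and a: "a \<in> A"
  shows "f a = g a"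
  using a
proof (induction a rule: less_induct)
  case (less a)
  have le: "h a \<le> h' a"
    if h: "strict_mono_on A h" "strict_mono_on A h'" "h ` A = h' ` A"
      and eq: "\<And>b. b \<in> A \<Longrightarrow> b < a \<Longrightarrow> h b = h' b" for h h' :: "nat \<Rightarrow> nat"
  proof -
    obtain b where b: "b \<in> A" "h' a = h b"
      using h(3) less.prems by (metis imageE imageI)
    have "\<not> b < a"
      using eq[of b] b h(2) less.prems by (metis less_irrefl strict_mono_onD)
    then show ?thesis
      using b h(1) less.prems by (metis le_less linorder_neqE_nat strict_mono_onD)
  qed
  show ?case
    using le[OF f g im] le[OF g f im[symmetric]] less.IH by (metis order_antisym)
qed

lemma is_unshuffle_ex1:
  assumes S: "S \<subseteq> {1..n}"
  shows "\<exists>!\<sigma>. is_unshuffle n S \<sigma>"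
proof -
  let ?k = "card S" and ?T = "{1..n} - S"
  let ?A = "{1..?k}" and ?B = "{?k + 1..n}"
  have fin: "finite S" "finite ?T"
    using S finite_subset by auto
  have kn: "?k \<le> n"
    using card_mono[OF _ S] by simp
  have cT: "card ?T = n - ?k"
    using S fin by (simp add: card_Diff_subset)
  have AB: "{1..n} = ?A \<union> ?B"
    using kn by auto
  let ?s = "sorted_list_of_set S" and ?t = "sorted_list_of_set ?T"
  have len: "length ?s = ?k" "length ?t = n - ?k"
    using fin cT by simp_all
  define \<sigma> where "\<sigma> p = (if p \<in> ?A then ?s ! (p - 1)
    else if p \<in> ?B then ?t ! (p - 1 - ?k) else p)" for p
  have A: "\<sigma> ` ?A = S"
  proof -
    have "\<sigma> ` ?A = (\<lambda>i. ?s ! i) ` ((\<lambda>p. p - 1) ` ?A)"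
      by (auto simp: \<sigma>_def image_image)
    also have "(\<lambda>p. p - 1) ` ?A = {..<length ?s}"
    proof (intro equalityI subsetI)
      fix x assume "x \<in> {..<length ?s}"
      then have "Suc x \<in> ?A" "x = Suc x - 1" using len by auto
      then show "x \<in> (\<lambda>p. p - 1) ` ?A" by blast
    qed (use len in auto)
    also have "(\<lambda>i. ?s ! i) ` {..<length ?s} = S"
      using set_sorted_list_of_set[OF fin(1)] unfolding set_conv_nth by auto
    finally show ?thesis .
  qed
  have B: "\<sigma> ` ?B = ?T"
  proof -
    have "\<sigma> ` ?B = (\<lambda>i. ?t ! i) ` ((\<lambda>p. p - 1 - ?k) ` ?B)"
      by (auto simp: \<sigma>_def image_image)
    also have "(\<lambda>p. p - 1 - ?k) ` ?B = {..<length ?t}"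
    proof (intro equalityI subsetI)
      fix x assume "x \<in> {..<length ?t}"
      then have "Suc x + ?k \<in> ?B" "x = Suc x + ?k - 1 - ?k" using len by auto
      then show "x \<in> (\<lambda>p. p - 1 - ?k) ` ?B" by blast
    qed (use len in auto)
    also have "(\<lambda>i. ?t ! i) ` {..<length ?t} = ?T"
      using set_sorted_list_of_set[OF fin(2)] unfolding set_conv_nth by auto
    finally show ?thesis .
  qed
  have mA: "strict_mono_on ?A \<sigma>"
  proof (rule strict_mono_onI)
    fix r q assume "r \<in> ?A" "q \<in> ?A" "r < q"
    then show "\<sigma> r < \<sigma> q"
      using len sorted_wrt_nth_less[OF strict_sorted_list_of_set, of "r - 1" "q - 1" S]
      by (auto simp: \<sigma>_def)
  qed
  have mB: "strict_mono_on ?B \<sigma>"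
  proof (rule strict_mono_onI)
    fix r q assume "r \<in> ?B" "q \<in> ?B" "r < q"
    then show "\<sigma> r < \<sigma> q"
      using len sorted_wrt_nth_less[OF strict_sorted_list_of_set, of "r - 1 - ?k" "q - 1 - ?k" ?T]
      by (auto simp: \<sigma>_def)
  qed
  have "\<sigma> ` {1..n} = {1..n}"
    unfolding AB image_Un A B using S AB by blast
  then have "bij_betw \<sigma> {1..n} {1..n}"
    by (simp add: bij_betw_def eq_card_imp_inj_on)
  then have "\<sigma> permutes {1..n}"
    by (rule bij_imp_permutes) (use AB in \<open>auto simp: \<sigma>_def\<close>)
  with A B mA mB have "is_unshuffle n S \<sigma>"
    by (simp add: is_unshuffle_def)
  moreover have "\<rho> = \<sigma>'" if "is_unshuffle n S \<rho>" "is_unshuffle n S \<sigma>'" for \<rho> \<sigma>'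
  proof
    fix p
    show "\<rho> p = \<sigma>' p"
    proof (cases "p \<in> {1..n}")
      case True
      then consider "p \<in> ?A" | "p \<in> ?B" using AB by blast
      then show ?thesis
        using that strict_mono_on_image_unique[of ?A \<rho> \<sigma>' p]
          strict_mono_on_image_unique[of ?B \<rho> \<sigma>' p]
        unfolding is_unshuffle_def by metis
    next
      case False
      then show ?thesis
        using that unfolding is_unshuffle_def by (metis permutes_not_in)
    qed
  qed
  ultimately show ?thesis by blast
qed

definition e_elt :: "nat \<Rightarrow> nat set \<Rightarrow> (nat gen_tree \<Rightarrow>\<^sub>0 real) set" where
  "e_elt n S = act com_triass n (unshuffle n S) (e_initial (card S) (n - card S))"


section \<open>The operad of games\<close>

text \<open>
  An \<open>n\<close>-player game is represented by a function on all sets of naturals that vanishes outside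
  \<open>Pow {1..n}\<close>. In \<open>game_pcomp\<close>, a coalition of the composed game is pulled back along the
  renumbering to coalitions of the players of \<open>\<alpha>\<close> other than \<open>i\<close> and of the players of \<open>\<beta>\<close>.
\<close>

type_synonym game = "nat set \<Rightarrow> real"

definition game_deriv :: "nat \<Rightarrow> game \<Rightarrow> game" where
  "game_deriv i \<alpha> T = \<alpha> (T \<union> {i}) - \<alpha> (T - {i})"

definition game_pcomp :: "nat \<Rightarrow> nat \<Rightarrow> nat \<Rightarrow> game \<Rightarrow> game \<Rightarrow> game" where
  "game_pcomp m n i \<alpha> \<beta> S =
     (if S \<subseteq> {1..m + n - 1} then
        let S\<^sub>A = {j \<in> {1..m} - {i}. outer_pos n i j \<in> S};
            S\<^sub>B = {k \<in> {1..n}. inner_pos i k \<in> S}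
        in \<beta> {1..n} * \<alpha> S\<^sub>A + game_deriv i \<alpha> S\<^sub>A * \<beta> S\<^sub>B
      else 0)"

definition games :: "game operad" where
  "games =
     \<lparr>component = (\<lambda>n.
        \<lparr>carrier = {v. v {} = 0 \<and> (\<forall>S. \<not> S \<subseteq> {1..n} \<longrightarrow> v S = 0)},
         monoid.mult = undefined, one = undefined, ring.zero = (\<lambda>S. 0),
         add = (\<lambda>v w S. v S + w S), smult = (\<lambda>r v S. r * v S)\<rparr>),
      act = (\<lambda>n \<sigma> v S. v (\<sigma> -` S)),
      pcomp = game_pcomp,
      opunit = (\<lambda>S. if S = {1} then 1 else 0)\<rparr>"

definition dictator_game :: game where
  "dictator_game S = (if S \<subseteq> {1, 2} \<and> 1 \<in> S then 1 else 0)"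

definition bargaining_game :: game where
  "bargaining_game S = (if S = {1, 2} then 1 else 0)"

definition moebius :: "game \<Rightarrow> game" where
  "moebius v S = (\<Sum>T\<in>Pow S. (- 1) ^ card (S - T) * v T)"

end

theory Submission
  imports Defs
begin

text \<open>
  Both operads are linearizations of one and the same combinatorial object, the operad whose
  operations of arity \<open>n\<close> are the nonempty subsets of \<open>[n]\<close>. On the side of games, a subset \<open>S\<close>
  stands for the unanimity game \<open>u\<^sub>S\<close>, which gives value \<open>1\<close> to the coalitions that contain \<open>S\<close>;
  composition turns unanimity games into unanimity games (\<open>unanimity_pcomp\<close>), and Moebius inversion
  says that every game is uniquely a combination \<open>\<Sum> \<mu>\<^sup>v(S) u\<^sub>S\<close> (\<open>game_moebius_expansion\<close>,
  \<open>unanimity_independent\<close>).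

  On the side of trees, \<open>S\<close> is the set of leading leaves: those reached from the root by always
  taking the first branch at a \<open>\<nu>\<close>-vertex and either branch at a \<open>\<mu>\<close>-vertex. Since
  \<open>d\<^sub>1\<close> is the unanimity game of \<open>{1}\<close> and \<open>B\<close> that of \<open>{1, 2}\<close>, the operad morphism from the free operad sends a tree to the
  unanimity game of its leading leaves. The two sides of each defining relation have the same
  leading leaves, so the operadic ideal lies in the kernel.

  The converse inclusion \<open>com_triass_ideal_eq_kernel\<close> is the heart of the proof: trees with the same
  labels and the same leading leaves are congruent modulo the ideal (\<open>tree_cong_of_leading\<close>). By the
  relations, every leaf \<open>d\<close> that is not leading can be moved to the root, \<open>t \<approx> \<nu>(s, d)\<close>, and when
  all leaves are leading every leaf \<open>x\<close> can, \<open>t \<approx> \<mu>(s, x)\<close>; induction on the number of leaves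
  finishes. Hence evaluation induces bijections from the quotient to the games. They respect all
  operations, so the operad axioms of games carry over to the quotient (\<open>operad_iso_transport\<close>).

  Finally a morphism that sends \<open>\<nu>\<close> to \<open>d\<^sub>1\<close> and \<open>\<mu>\<close> to \<open>B\<close> must send \<open>e\<^sub>S\<close> to \<open>u\<^sub>S\<close>
  (\<open>e_elt_value\<close>). Uniqueness, the basis property and the formula for the inverse all follow from
  the expansion of games in unanimity games.
\<close>

section \<open>Transport of structure along bijections\<close>
lemma real_ring_simps [simp]:
  "carrier real_ring = UNIV" "x \<otimes>\<^bsub>real_ring\<^esub> y = x * y" "\<one>\<^bsub>real_ring\<^esub> = 1"
  "\<zero>\<^bsub>real_ring\<^esub> = 0" "x \<oplus>\<^bsub>real_ring\<^esub> y = x + y"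
  by (simp_all add: real_ring_def)

lemma cring_real_ring: "cring real_ring"
proof (intro cringI abelian_groupI comm_monoidI)
  fix x :: real
  show "\<exists>y\<in>carrier real_ring. y \<oplus>\<^bsub>real_ring\<^esub> x = \<zero>\<^bsub>real_ring\<^esub>"
    by (rule bexI[of _ "- x"]) simp_all
qed (simp_all add: algebra_simps)

lemma lin_map_finsum:
  assumes V: "vec_space V" and W: "vec_space W" and f: "lin_map V W f"
    and J: "finite J" and g: "g \<in> J \<rightarrow> carrier V"
  shows "f (\<Oplus>\<^bsub>V\<^esub>j\<in>J. g j) = (\<Oplus>\<^bsub>W\<^esub>j\<in>J. f (g j))"
proof -
  interpret V: module real_ring V by (rule V)
  interpret W: module real_ring W by (rule W)
  have closed: "f x \<in> carrier W" if "x \<in> carrier V" for x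
    using f that by (auto simp: lin_map_def)
  have "f (0 \<odot>\<^bsub>V\<^esub> \<zero>\<^bsub>V\<^esub>) = 0 \<odot>\<^bsub>W\<^esub> f \<zero>\<^bsub>V\<^esub>"
    using f V.zero_closed unfolding lin_map_def by blast
  then have zero: "f \<zero>\<^bsub>V\<^esub> = \<zero>\<^bsub>W\<^esub>"
    using V.smult_l_null[of "\<zero>\<^bsub>V\<^esub>"] W.smult_l_null[OF closed[of "\<zero>\<^bsub>V\<^esub>"]] by simp
  show ?thesis
    using J g
  proof (induction J)
    case empty
    then show ?case by (simp add: zero)
  next
    case (insert j J)
    then have g: "g j \<in> carrier V" "g \<in> J \<rightarrow> carrier V" by auto
    then have "f (\<Oplus>\<^bsub>V\<^esub>j\<in>insert j J. g j) = f (g j \<oplus>\<^bsub>V\<^esub> (\<Oplus>\<^bsub>V\<^esub>j\<in>J. g j))"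
      using insert.hyps by simp
    also have "\<dots> = f (g j) \<oplus>\<^bsub>W\<^esub> f (\<Oplus>\<^bsub>V\<^esub>j\<in>J. g j)"
      using f g by (simp add: lin_map_def)
    also have "\<dots> = (\<Oplus>\<^bsub>W\<^esub>j\<in>insert j J. f (g j))"
      using insert g by (subst W.finsum_insert) (auto simp: closed Pi_iff)
    finally show ?case .
  qed
qed

text \<open>Every vector space axiom is an equation or a closure property, and both can be checked after
  applying an injective map that respects the operations.\<close>

lemma vec_space_transport:
  assumes W: "vec_space W" and bij: "bij_betw f (carrier V) (carrier W)"
    and zero: "\<zero>\<^bsub>V\<^esub> \<in> carrier V" "f \<zero>\<^bsub>V\<^esub> = \<zero>\<^bsub>W\<^esub>"
    and add: "\<And>x y. \<lbrakk>x \<in> carrier V; y \<in> carrier V\<rbrakk> \<Longrightarrow> x \<oplus>\<^bsub>V\<^esub> y \<in> carrier V"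
      "\<And>x y. \<lbrakk>x \<in> carrier V; y \<in> carrier V\<rbrakk> \<Longrightarrow> f (x \<oplus>\<^bsub>V\<^esub> y) = f x \<oplus>\<^bsub>W\<^esub> f y"
    and smult: "\<And>r x. x \<in> carrier V \<Longrightarrow> r \<odot>\<^bsub>V\<^esub> x \<in> carrier V"
      "\<And>r x. x \<in> carrier V \<Longrightarrow> f (r \<odot>\<^bsub>V\<^esub> x) = r \<odot>\<^bsub>W\<^esub> f x"
  shows "vec_space V"
proof -
  interpret W: module real_ring W by (rule W)
  have closed: "f x \<in> carrier W" if "x \<in> carrier V" for x
    using bij that by (auto simp: bij_betw_def)
  have eqI: "x = y" if "x \<in> carrier V" "y \<in> carrier V" "f x = f y" for x y
    using bij that by (auto simp: bij_betw_def inj_on_def)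
  show ?thesis
  proof (intro moduleI cring_real_ring abelian_groupI)
    fix x assume x: "x \<in> carrier V"
    have "\<zero>\<^bsub>W\<^esub> = 0 \<odot>\<^bsub>W\<^esub> f x" "f x = 1 \<odot>\<^bsub>W\<^esub> f x"
      using W.smult_l_null W.smult_one x closed by auto
    then have "(-1) \<odot>\<^bsub>W\<^esub> f x \<oplus>\<^bsub>W\<^esub> f x = \<zero>\<^bsub>W\<^esub>"
      using W.smult_l_distr[of "-1" 1 "f x"] x closed by simp
    then show "\<exists>y\<in>carrier V. y \<oplus>\<^bsub>V\<^esub> x = \<zero>\<^bsub>V\<^esub>"
      using x by (intro bexI[of _ "(-1) \<odot>\<^bsub>V\<^esub> x"] eqI) (auto simp: zero add smult)
  next
    fix a b :: real and x assume x: "x \<in> carrier V"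
    show "(a \<oplus>\<^bsub>real_ring\<^esub> b) \<odot>\<^bsub>V\<^esub> x = a \<odot>\<^bsub>V\<^esub> x \<oplus>\<^bsub>V\<^esub> b \<odot>\<^bsub>V\<^esub> x"
      using x W.smult_l_distr[of a b "f x"] by (intro eqI) (auto simp: add smult closed)
  next
    fix a b :: real and x assume x: "x \<in> carrier V"
    show "(a \<otimes>\<^bsub>real_ring\<^esub> b) \<odot>\<^bsub>V\<^esub> x = a \<odot>\<^bsub>V\<^esub> (b \<odot>\<^bsub>V\<^esub> x)"
      using x W.smult_assoc1[of a b "f x"] by (intro eqI) (auto simp: add smult closed)
  next
    fix a :: real and x y assume x: "x \<in> carrier V" "y \<in> carrier V"
    show "a \<odot>\<^bsub>V\<^esub> (x \<oplus>\<^bsub>V\<^esub> y) = a \<odot>\<^bsub>V\<^esub> x \<oplus>\<^bsub>V\<^esub> a \<odot>\<^bsub>V\<^esub> y"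
      using x W.smult_r_distr[of a "f x" "f y"] by (intro eqI) (auto simp: add smult closed)
  next
    fix x assume x: "x \<in> carrier V"
    show "\<one>\<^bsub>real_ring\<^esub> \<odot>\<^bsub>V\<^esub> x = x"
      using x W.smult_one[of "f x"] by (intro eqI) (auto simp: add smult closed)
  next
    fix x y z assume x: "x \<in> carrier V" "y \<in> carrier V" "z \<in> carrier V"
    show "x \<oplus>\<^bsub>V\<^esub> y \<oplus>\<^bsub>V\<^esub> z = x \<oplus>\<^bsub>V\<^esub> (y \<oplus>\<^bsub>V\<^esub> z)"
      using x W.a_assoc[of "f x" "f y" "f z"] by (intro eqI) (auto simp: add closed)
    show "x \<oplus>\<^bsub>V\<^esub> y = y \<oplus>\<^bsub>V\<^esub> x"
      using x W.a_comm[of "f x" "f y"] by (intro eqI) (auto simp: add closed)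
    show "\<zero>\<^bsub>V\<^esub> \<oplus>\<^bsub>V\<^esub> x = x"
      using x W.l_zero[of "f x"] by (intro eqI) (auto simp: add closed zero)
  qed (simp_all add: zero add smult)
qed

lemma perm_pcomp_inner:
  assumes "k \<in> {1..n}"
  shows "perm_pcomp n i \<sigma> \<tau> (inner_pos i k) = inner_pos (\<sigma> i) (\<tau> k)"
  using assms by (auto simp: perm_pcomp_def inner_pos_def)

lemma perm_pcomp_outer:
  assumes "j \<noteq> i"
  shows "perm_pcomp n i \<sigma> \<tau> (outer_pos n i j) = outer_pos n (\<sigma> i) (\<sigma> j)"
  using assms by (auto simp: perm_pcomp_def outer_pos_def)

text \<open>The inputs of a composite are the disjoint union of the inner and the outer ones.\<close>

lemma pos_cases:
  assumes "i \<in> {1..m}" "p \<in> {1..m + n - 1}"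
  obtains k where "k \<in> {1..n}" "p = inner_pos i k"
    | j where "j \<in> {1..m}" "j \<noteq> i" "p = outer_pos n i j"
proof -
  consider "p < i" | "i \<le> p" "p < i + n" | "i + n \<le> p" by linarith
  then show thesis
  proof cases
    case 1
    then show thesis using assms that(2)[of p] by (auto simp: outer_pos_def)
  next
    case 2
    then have "p + 1 - i \<in> {1..n}" "p = inner_pos i (p + 1 - i)"
      using assms by (auto simp: inner_pos_def)
    then show thesis by (rule that(1))
  next
    case 3
    then have "p + 1 - n \<in> {1..m}" "p + 1 - n \<noteq> i" "p = outer_pos n i (p + 1 - n)"
      using assms by (auto simp: outer_pos_def)
    then show thesis by (rule that(2))
  qed
qed

lemma inner_pos_in: "\<lbrakk>i \<in> {1..m}; k \<in> {1..n}\<rbrakk> \<Longrightarrow> inner_pos i k \<in> {1..m + n - 1}"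
  by (auto simp: inner_pos_def)

lemma outer_pos_in: "\<lbrakk>i \<in> {1..m}; j \<in> {1..m}; j \<noteq> i\<rbrakk> \<Longrightarrow> outer_pos n i j \<in> {1..m + n - 1}"
  by (auto simp: outer_pos_def)

text \<open>This holds also for \<open>n = 0\<close>, where the composite merely loses the input \<open>i\<close>.\<close>

lemma perm_pcomp_permutes:
  assumes i: "i \<in> {1..m}" and \<sigma>: "\<sigma> permutes {1..m}" and \<tau>: "\<tau> permutes {1..n}"
  shows "perm_pcomp n i \<sigma> \<tau> permutes {1..m + n - 1}"
proof -
  let ?\<pi> = "perm_pcomp n i \<sigma> \<tau>" and ?N = "{1..m + n - 1}"
  have \<sigma>i: "\<sigma> i \<in> {1..m}"
    using i \<sigma> by (meson permutes_in_image)
  have "?\<pi> ` ?N = ?N"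
  proof (intro equalityI subsetI)
    fix q assume "q \<in> ?\<pi> ` ?N"
    then obtain p where p: "p \<in> ?N" "q = ?\<pi> p" by blast
    from i p(1) show "q \<in> ?N"
    proof (cases rule: pos_cases)
      case (1 k)
      moreover have "\<tau> k \<in> {1..n}" using \<tau> 1 by (meson permutes_in_image)
      ultimately show ?thesis
        using inner_pos_in[OF \<sigma>i] p by (simp add: perm_pcomp_inner del: atLeastAtMost_iff)
    next
      case (2 j)
      moreover have "\<sigma> j \<in> {1..m}" "\<sigma> j \<noteq> \<sigma> i"
        using \<sigma> 2 by (meson permutes_in_image, metis permutes_inj injD)
      ultimately show ?thesis
        using outer_pos_in[OF \<sigma>i] p by (simp add: perm_pcomp_outer del: atLeastAtMost_iff)
    qed
  next
    fix q assume "q \<in> ?N"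
    with \<sigma>i show "q \<in> ?\<pi> ` ?N"
    proof (cases rule: pos_cases)
      case (1 k)
      then obtain k' where k': "k' \<in> {1..n}" "k = \<tau> k'"
        using permutes_image[OF \<tau>] by blast
      then have "q = ?\<pi> (inner_pos i k')" using 1 by (simp add: perm_pcomp_inner)
      then show ?thesis using inner_pos_in[OF i k'(1)] by blast
    next
      case (2 j)
      then obtain j' where j': "j' \<in> {1..m}" "j = \<sigma> j'"
        using permutes_image[OF \<sigma>] by blast
      with 2 have "j' \<noteq> i" by blast
      then have "q = ?\<pi> (outer_pos n i j')" using 2 j' by (simp add: perm_pcomp_outer)
      then show ?thesis using outer_pos_in[OF i j'(1) \<open>j' \<noteq> i\<close>] by blast
    qed
  qed
  then have "bij_betw ?\<pi> ?N ?N"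
    by (simp add: bij_betw_def eq_card_imp_inj_on)
  moreover have "?\<pi> p = p" if "p \<notin> ?N" for p
  proof (cases "p = 0")
    case True
    then show ?thesis
      using i \<sigma>i permutes_not_in[OF \<sigma>, of 0] by (simp add: perm_pcomp_def outer_pos_def)
  next
    case False
    then have "\<not> p < i + n" "p + 1 - n \<notin> {1..m}" using that i by auto
    then show ?thesis
      using permutes_not_in[OF \<sigma>, of "p + 1 - n"] \<sigma>i
      by (auto simp: perm_pcomp_def outer_pos_def)
  qed
  ultimately show ?thesis
    by (rule bij_imp_permutes)
qed

text \<open>Only closure and compatibility are required of \<open>P\<close>: as for vector spaces, each operad axiom
  for \<open>P\<close> is an equation that may be tested under the injective maps \<open>\<phi> n\<close>.\<close>

lemma operad_iso_transport:
  assumes Q: "operad Q" and bij: "\<And>n. bij_betw (\<phi> n) (elts P n) (elts Q n)"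
    and zero: "\<And>n. \<zero>\<^bsub>component P n\<^esub> \<in> elts P n"
      "\<And>n. \<phi> n \<zero>\<^bsub>component P n\<^esub> = \<zero>\<^bsub>component Q n\<^esub>"
    and add: "\<And>n x y. \<lbrakk>x \<in> elts P n; y \<in> elts P n\<rbrakk> \<Longrightarrow> x \<oplus>\<^bsub>component P n\<^esub> y \<in> elts P n"
      "\<And>n x y. \<lbrakk>x \<in> elts P n; y \<in> elts P n\<rbrakk> \<Longrightarrow>
        \<phi> n (x \<oplus>\<^bsub>component P n\<^esub> y) = \<phi> n x \<oplus>\<^bsub>component Q n\<^esub> \<phi> n y"
    and smult: "\<And>n r x. x \<in> elts P n \<Longrightarrow> r \<odot>\<^bsub>component P n\<^esub> x \<in> elts P n"
      "\<And>n r x. x \<in> elts P n \<Longrightarrow>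
        \<phi> n (r \<odot>\<^bsub>component P n\<^esub> x) = r \<odot>\<^bsub>component Q n\<^esub> \<phi> n x"
    and action: "\<And>n \<sigma> x. \<lbrakk>\<sigma> permutes {1..n}; x \<in> elts P n\<rbrakk> \<Longrightarrow> act P n \<sigma> x \<in> elts P n"
      "\<And>n \<sigma> x. \<lbrakk>\<sigma> permutes {1..n}; x \<in> elts P n\<rbrakk> \<Longrightarrow> \<phi> n (act P n \<sigma> x) = act Q n \<sigma> (\<phi> n x)"
    and comp: "\<And>m n i x y. \<lbrakk>i \<in> {1..m}; x \<in> elts P m; y \<in> elts P n\<rbrakk> \<Longrightarrow>
        pcomp P m n i x y \<in> elts P (m + n - 1)"
      "\<And>m n i x y. \<lbrakk>i \<in> {1..m}; x \<in> elts P m; y \<in> elts P n\<rbrakk> \<Longrightarrow>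
        \<phi> (m + n - 1) (pcomp P m n i x y) = pcomp Q m n i (\<phi> m x) (\<phi> n y)"
    and unit: "opunit P \<in> elts P 1" "\<phi> 1 (opunit P) = opunit Q"
  shows "operad_iso P Q \<phi>"
proof -
  interpret Q: operad Q by (rule Q)
  have closed: "\<phi> n x \<in> elts Q n" if "x \<in> elts P n" for n x
    using bij[of n] that by (auto simp: bij_betw_def)
  have eqI: "x = y" if "x \<in> elts P n" "y \<in> elts P n" "\<phi> n x = \<phi> n y" for n x y
    using bij[of n] that by (auto simp: bij_betw_def inj_on_def)
  have fun_closed: "\<phi> n \<in> elts P n \<rightarrow> elts Q n" for n
    using closed by blast
  have hom_lin: "lin_map (component P n) (component Q n) (\<phi> n)" for n
    using fun_closed add smult by (simp add: lin_map_def)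
  have P: "operad P"
  proof (rule operad.intro)
    show "vec_space (component P n)" for n
      by (rule vec_space_transport[OF Q.vec_space_component bij]) (use zero add smult in auto)
    show "lin_map (component P n) (component P n) (act P n \<sigma>)" if "\<sigma> permutes {1..n}" for n \<sigma>
      using Q.act_lin[OF that] that unfolding lin_map_def
      by (auto intro!: eqI[of _ n] simp: add smult action closed)
    show "act P n id x = x" if "x \<in> elts P n" for n x
      using that Q.act_id[OF closed[OF that]]
      by (intro eqI[of _ n]) (auto simp: action permutes_id)
    show "act P n (\<sigma> \<circ> \<tau>) x = act P n \<sigma> (act P n \<tau> x)"
      if "\<sigma> permutes {1..n}" "\<tau> permutes {1..n}" "x \<in> elts P n" for n \<sigma> \<tau> x
      using that Q.act_comp[OF that(1,2) closed[OF that(3)]] permutes_compose[OF that(2,1)]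
      by (intro eqI[of _ n]) (auto simp: action)
    show "lin_map (component P m) (component P (m + n - 1)) (\<lambda>x. pcomp P m n i x y)"
      if "i \<in> {1..m}" "y \<in> elts P n" for i m n y
      using Q.pcomp_lin_left[OF that(1) closed[OF that(2)]] that unfolding lin_map_def
      by (auto intro!: eqI[of _ "m + n - 1"] simp: add smult comp closed simp del: atLeastAtMost_iff One_nat_def)
    show "lin_map (component P n) (component P (m + n - 1)) (pcomp P m n i x)"
      if "i \<in> {1..m}" "x \<in> elts P m" for i m n x
      using Q.pcomp_lin_right[OF that(1) closed[OF that(2)]] that unfolding lin_map_def
      by (auto intro!: eqI[of _ "m + n - 1"] simp: add smult comp closed simp del: atLeastAtMost_iff One_nat_def)
    show "pcomp P (l + m - 1) n (i + j - 1) (pcomp P l m i x y) z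
        = pcomp P l (m + n - 1) i x (pcomp P m n j y z)"
      if "i \<in> {1..l}" "j \<in> {1..m}" "x \<in> elts P l" "y \<in> elts P m" "z \<in> elts P n"
      for i l j m n x y z
    proof (rule eqI[of _ "l + m - 1 + n - 1"])
      have idx: "i + j - 1 \<in> {1..l + m - 1}" "l + m - 1 + n - 1 = l + (m + n - 1) - 1"
        using that by auto
      show "pcomp P (l + m - 1) n (i + j - 1) (pcomp P l m i x y) z \<in> elts P (l + m - 1 + n - 1)"
        using that idx by (intro comp) auto
      show "pcomp P l (m + n - 1) i x (pcomp P m n j y z) \<in> elts P (l + m - 1 + n - 1)"
        unfolding idx(2) using that by (intro comp) auto
      show "\<phi> (l + m - 1 + n - 1) (pcomp P (l + m - 1) n (i + j - 1) (pcomp P l m i x y) z)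
          = \<phi> (l + m - 1 + n - 1) (pcomp P l (m + n - 1) i x (pcomp P m n j y z))"
        using Q.pcomp_sequential[OF that(1,2) closed closed closed] that
        by (subst comp(2)[OF idx(1)], simp_all only: comp idx(2))
    qed
    show "pcomp P (l + m - 1) n (k + m - 1) (pcomp P l m i x y) z
        = pcomp P (l + n - 1) m i (pcomp P l n k x z) y"
      if "i \<in> {1..l}" "k \<in> {1..l}" "i < k" "x \<in> elts P l" "y \<in> elts P m" "z \<in> elts P n"
      for i l k m n x y z
    proof (rule eqI[of _ "l + m - 1 + n - 1"])
      have idx: "k + m - 1 \<in> {1..l + m - 1}" "i \<in> {1..l + n - 1}"
        "l + m - 1 + n - 1 = l + n - 1 + m - 1"
        using that by auto
      show "pcomp P (l + m - 1) n (k + m - 1) (pcomp P l m i x y) z \<in> elts P (l + m - 1 + n - 1)"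
        using that idx by (intro comp) auto
      show "pcomp P (l + n - 1) m i (pcomp P l n k x z) y \<in> elts P (l + m - 1 + n - 1)"
        unfolding idx(3) using that idx by (intro comp) auto
      show "\<phi> (l + m - 1 + n - 1) (pcomp P (l + m - 1) n (k + m - 1) (pcomp P l m i x y) z)
          = \<phi> (l + m - 1 + n - 1) (pcomp P (l + n - 1) m i (pcomp P l n k x z) y)"
        using Q.pcomp_parallel[OF that(1,2,3) closed closed closed] that
        by (subst comp(2)[OF idx(1)], simp_all only: comp idx(2,3))
    qed
    show "opunit P \<in> elts P 1"
      by (rule unit)
    show "pcomp P 1 n 1 (opunit P) x = x" if "x \<in> elts P n" for n x
    proof (rule eqI[of _ n])
      show "pcomp P 1 n 1 (opunit P) x \<in> elts P n"
        using comp(1)[of 1 1 "opunit P" x n] that unit by simp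
      show "\<phi> n (pcomp P 1 n 1 (opunit P) x) = \<phi> n x"
        using comp(2)[of 1 1 "opunit P" x n] that unit Q.opunit_left[OF closed[OF that]] by simp
    qed (rule that)
    show "pcomp P n 1 i x (opunit P) = x" if "i \<in> {1..n}" "x \<in> elts P n" for i n x
    proof (rule eqI[of _ n])
      show "pcomp P n 1 i x (opunit P) \<in> elts P n"
        using comp(1)[of i n x "opunit P" 1] that unit by simp
      show "\<phi> n (pcomp P n 1 i x (opunit P)) = \<phi> n x"
        using comp(2)[of i n x "opunit P" 1] that unit Q.opunit_right[OF that(1) closed[OF that(2)]]
        by simp
    qed (rule that)
    show "pcomp P m n (\<sigma> i) (act P m \<sigma> x) (act P n \<tau> y)
        = act P (m + n - 1) (perm_pcomp n i \<sigma> \<tau>) (pcomp P m n i x y)"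
      if h: "i \<in> {1..m}" "\<sigma> permutes {1..m}" "\<tau> permutes {1..n}" "x \<in> elts P m" "y \<in> elts P n"
      for i m n \<sigma> \<tau> x y
    proof (rule eqI[of _ "m + n - 1"])
      have \<sigma>i: "\<sigma> i \<in> {1..m}"
        using h by (meson permutes_in_image)
      note \<pi> = perm_pcomp_permutes[OF h(1-3)]
      show "pcomp P m n (\<sigma> i) (act P m \<sigma> x) (act P n \<tau> y) \<in> elts P (m + n - 1)"
        using h \<sigma>i by (intro comp action)
      show "act P (m + n - 1) (perm_pcomp n i \<sigma> \<tau>) (pcomp P m n i x y) \<in> elts P (m + n - 1)"
        using h \<pi> by (intro comp action)
      show "\<phi> (m + n - 1) (pcomp P m n (\<sigma> i) (act P m \<sigma> x) (act P n \<tau> y))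
          = \<phi> (m + n - 1) (act P (m + n - 1) (perm_pcomp n i \<sigma> \<tau>) (pcomp P m n i x y))"
        using Q.pcomp_equivariant[OF h(1-3) closed closed] h \<sigma>i \<pi> by (simp only: comp action)
    qed
  qed
  interpret P: operad P by (rule P)
  show ?thesis
    by unfold_locales (use hom_lin action comp unit bij in auto)
qed

section \<open>The operad of games\<close>
lemma games_simps [simp]:
  "elts games n = {v. v {} = 0 \<and> (\<forall>S. \<not> S \<subseteq> {1..n} \<longrightarrow> v S = 0)}"
  "\<zero>\<^bsub>component games n\<^esub> = (\<lambda>S. 0)"
  "v \<oplus>\<^bsub>component games n\<^esub> w = (\<lambda>S. v S + w S)"
  "r \<odot>\<^bsub>component games n\<^esub> v = (\<lambda>S. r * v S)"
  "act games n \<sigma> v = (\<lambda>S. v (\<sigma> -` S))"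
  "pcomp games = game_pcomp"
  "opunit games = (\<lambda>S. if S = {1} then 1 else 0)"
  by (simp_all add: games_def)

lemma vec_space_games: "vec_space (component games n)"
proof (intro moduleI cring_real_ring abelian_groupI)
  fix v assume "v \<in> elts games n"
  then show "\<exists>w\<in>elts games n. w \<oplus>\<^bsub>component games n\<^esub> v = \<zero>\<^bsub>component games n\<^esub>"
    by (intro bexI[of _ "\<lambda>S. - v S"]) auto
qed (auto simp: algebra_simps)

lemma games_finsum:
  assumes "finite J" "g \<in> J \<rightarrow> elts games n"
  shows "(\<Oplus>\<^bsub>component games n\<^esub>j\<in>J. g j) = (\<lambda>S. \<Sum>j\<in>J. g j S)"
proof -
  interpret module real_ring "component games n" by (rule vec_space_games)
  show ?thesis using assms
  proof (induction J)
    case (insert j J)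
    then show ?case by (subst M.finsum_insert) (auto simp: Pi_iff)
  qed simp
qed

text \<open>The two preimages of a coalition under the renumbering of the players.\<close>

definition outer_part :: "nat \<Rightarrow> nat \<Rightarrow> nat \<Rightarrow> nat set \<Rightarrow> nat set" where
  "outer_part m n i S = {j \<in> {1..m} - {i}. outer_pos n i j \<in> S}"

definition inner_part :: "nat \<Rightarrow> nat \<Rightarrow> nat set \<Rightarrow> nat set" where
  "inner_part n i S = {k \<in> {1..n}. inner_pos i k \<in> S}"

lemma game_pcomp_parts:
  assumes "S \<subseteq> {1..m + n - 1}"
  shows "game_pcomp m n i \<alpha> \<beta> S =
    \<beta> {1..n} * \<alpha> (outer_part m n i S)
    + (\<alpha> (insert i (outer_part m n i S)) - \<alpha> (outer_part m n i S)) * \<beta> (inner_part n i S)"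
proof -
  have "outer_part m n i S - {i} = outer_part m n i S"
    by (auto simp: outer_part_def)
  then show ?thesis
    using assms unfolding game_pcomp_def game_deriv_def Let_def
      outer_part_def[symmetric] inner_part_def[symmetric] by simp
qed

lemma game_pcomp_outside: "\<not> S \<subseteq> {1..m + n - 1} \<Longrightarrow> game_pcomp m n i \<alpha> \<beta> S = 0"
  by (simp add: game_pcomp_def)

lemma game_pcomp_closed:
  assumes "\<alpha> \<in> elts games m" "\<beta> \<in> elts games n"
  shows "game_pcomp m n i \<alpha> \<beta> \<in> elts games (m + n - 1)"
proof -
  have "outer_part m n i {} = {}" "inner_part n i {} = {}"
    by (auto simp: outer_part_def inner_part_def)
  then show ?thesis
    using assms game_pcomp_parts[of "{}"] by (auto simp: game_pcomp_outside)
qed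

lemma game_pcomp_linear:
  "game_pcomp m n i (\<lambda>S. \<alpha> S + \<alpha>' S) \<beta> = (\<lambda>S. game_pcomp m n i \<alpha> \<beta> S + game_pcomp m n i \<alpha>' \<beta> S)"
  "game_pcomp m n i (\<lambda>S. r * \<alpha> S) \<beta> = (\<lambda>S. r * game_pcomp m n i \<alpha> \<beta> S)"
  "game_pcomp m n i \<alpha> (\<lambda>S. \<beta> S + \<beta>' S) = (\<lambda>S. game_pcomp m n i \<alpha> \<beta> S + game_pcomp m n i \<alpha> \<beta>' S)"
  "game_pcomp m n i \<alpha> (\<lambda>S. r * \<beta> S) = (\<lambda>S. r * game_pcomp m n i \<alpha> \<beta> S)"
  by (auto simp: fun_eq_iff game_pcomp_def game_deriv_def Let_def ring_distribs)

lemma outer_pos_inj: "\<lbrakk>outer_pos n i j = outer_pos n i j'; i \<ge> 1; j \<noteq> i; j' \<noteq> i\<rbrakk> \<Longrightarrow> j = j'"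
  by (auto simp: outer_pos_def split: if_splits)

lemma outer_pos_neq_inner_pos: "\<lbrakk>k \<in> {1..n}; i \<ge> 1; j \<noteq> i\<rbrakk> \<Longrightarrow> outer_pos n i j \<noteq> inner_pos i k"
  by (auto simp: outer_pos_def inner_pos_def)

text \<open>The value of the grand coalition is multiplicative, as both summands of the composite
  contribute and the terms \<open>\<alpha> ([m] - {i})\<close> cancel. It enters the sequential axiom because the
  composition formula uses the value \<open>\<beta>(B)\<close>.\<close>

lemma game_pcomp_grand:
  assumes i: "i \<in> {1..m}" and \<alpha>: "\<alpha> \<in> elts games m" and \<beta>: "\<beta> \<in> elts games n"
  shows "game_pcomp m n i \<alpha> \<beta> {1..m + n - 1} = \<alpha> {1..m} * \<beta> {1..n}"
proof -
  have "outer_part m n i {1..m + n - 1} = {1..m} - {i}" "inner_part n i {1..m + n - 1} = {1..n}"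
    using i inner_pos_in[OF i] outer_pos_in[OF i] by (auto simp: outer_part_def inner_part_def)
  moreover have "insert i ({1..m} - {i}) = {1..m}" using i by auto
  ultimately show ?thesis
    by (simp add: game_pcomp_parts algebra_simps)
qed

lemma permutes_vimage_subset_iff:
  assumes "\<sigma> permutes A"
  shows "\<sigma> -` S \<subseteq> A \<longleftrightarrow> S \<subseteq> A"
proof -
  have "\<sigma> -` A = A"
    using permutes_in_image[OF assms] by auto
  moreover have "\<sigma> ` \<sigma> -` S = S"
    using permutes_surj[OF assms] by (rule surj_image_vimage_eq)
  ultimately show ?thesis
    using image_mono[of "\<sigma> -` S" A \<sigma>] vimage_mono[of S A \<sigma>] permutes_image[OF assms] by auto
qed

text \<open>The following identities are the associativity of renumbering, read on coalitions: pulling back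
  along a twofold composite gives the same parts in whichever order it is formed.\<close>

lemma inner_part_nested_inner:
  assumes i: "i \<in> {1..l}" and j: "j \<in> {1..m}"
  shows "inner_part n j (inner_part (m + n - 1) i S) = inner_part n (i + j - 1) S"
proof -
  have "inner_pos i (inner_pos j k) = inner_pos (i + j - 1) k" if "k \<in> {1..n}" for k
    using that assms by (auto simp: inner_pos_def)
  then show ?thesis
    using inner_pos_in[OF j] unfolding inner_part_def by fastforce
qed

lemma outer_part_nested_inner:
  assumes i: "i \<in> {1..l}" and j: "j \<in> {1..m}"
  shows "outer_part m n j (inner_part (m + n - 1) i S)
    = inner_part m i (outer_part (l + m - 1) n (i + j - 1) S)"
proof -
  have "inner_pos i (outer_pos n j j') = outer_pos n (i + j - 1) (inner_pos i j')"
    "inner_pos i j' \<noteq> i + j - 1" if "j' \<in> {1..m} - {j}" for j'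
    using that assms by (auto simp: inner_pos_def outer_pos_def)
  moreover have "inner_pos i j = i + j - 1"
    by (simp add: inner_pos_def)
  ultimately show ?thesis
    using inner_pos_in[OF i] outer_pos_in[OF j]
    unfolding inner_part_def outer_part_def by fastforce
qed

lemma outer_part_nested_outer:
  assumes i: "i \<in> {1..l}" and j: "j \<in> {1..m}"
  shows "outer_part l m i (outer_part (l + m - 1) n (i + j - 1) S) = outer_part l (m + n - 1) i S"
proof -
  have "outer_pos n (i + j - 1) (outer_pos m i a) = outer_pos (m + n - 1) i a"
    "outer_pos m i a \<noteq> i + j - 1" if "a \<in> {1..l} - {i}" for a
    using that assms by (auto simp: outer_pos_def)
  then show ?thesis
    using outer_pos_in[OF i] unfolding outer_part_def by fastforce
qed

lemma inner_part_outer_part_before: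
  assumes "i \<in> {1..l}" "k \<in> {1..l}" "i < k"
  shows "inner_part m i (outer_part (l + m - 1) n (k + m - 1) S) = inner_part m i S"
proof -
  have "outer_pos n (k + m - 1) (inner_pos i b) = inner_pos i b"
    "inner_pos i b \<noteq> k + m - 1" if "b \<in> {1..m}" for b
    using that assms by (auto simp: inner_pos_def outer_pos_def)
  then show ?thesis
    using inner_pos_in[OF assms(1)] unfolding inner_part_def outer_part_def by fastforce
qed

lemma inner_part_outer_part_after:
  assumes "i \<in> {1..l}" "k \<in> {1..l}" "i < k"
  shows "inner_part n k (outer_part (l + n - 1) m i S) = inner_part n (k + m - 1) S"
proof -
  have "outer_pos m i (inner_pos k c) = inner_pos (k + m - 1) c"
    "inner_pos k c \<noteq> i" if "c \<in> {1..n}" for c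
    using that assms by (auto simp: inner_pos_def outer_pos_def)
  then show ?thesis
    using inner_pos_in[OF assms(2)] unfolding inner_part_def outer_part_def by fastforce
qed

lemma outer_part_outer_part:
  assumes "i \<in> {1..l}" "k \<in> {1..l}" "i < k"
  shows "outer_part l m i (outer_part (l + m - 1) n (k + m - 1) S)
    = outer_part l n k (outer_part (l + n - 1) m i S)"
proof -
  have "outer_pos n (k + m - 1) (outer_pos m i a) = outer_pos m i (outer_pos n k a)"
    "outer_pos m i a \<noteq> k + m - 1" "outer_pos n k a \<noteq> i" if "a \<in> {1..l}" "a \<noteq> i" "a \<noteq> k" for a
    using that assms by (auto simp: outer_pos_def)
  moreover have "outer_pos m i k = k + m - 1" "outer_pos n k i = i"
    using assms by (auto simp: outer_pos_def)
  ultimately show ?thesis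
    using outer_pos_in[OF assms(1)] outer_pos_in[OF assms(2)] unfolding outer_part_def by fastforce
qed

text \<open>A discrete derivative adds one player to a coalition; these rules say which part this player
  joins.\<close>

lemma inner_part_insert_inner:
  "j \<in> {1..m} \<Longrightarrow> i \<ge> 1 \<Longrightarrow> inner_part m i (insert (i + j - 1) S) = insert j (inner_part m i S)"
  by (auto simp: inner_part_def inner_pos_def)

lemma outer_part_insert_inner:
  "j \<in> {1..m} \<Longrightarrow> i \<ge> 1 \<Longrightarrow> outer_part l m i (insert (i + j - 1) S) = outer_part l m i S"
  by (auto simp: outer_part_def outer_pos_def)

lemma inner_part_insert_outer:
  "j \<noteq> i \<Longrightarrow> i \<ge> 1 \<Longrightarrow> inner_part m i (insert (outer_pos m i j) S) = inner_part m i S"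
  by (auto simp: inner_part_def inner_pos_def outer_pos_def split: if_splits)

lemma outer_part_insert_outer:
  assumes "j \<in> {1..l}" "j \<noteq> i" "i \<ge> 1"
  shows "outer_part l m i (insert (outer_pos m i j) S) = insert j (outer_part l m i S)"
  using assms outer_pos_inj[of m i _ j] by (auto simp: outer_part_def)

text \<open>After splitting coalitions into their parts, both sides of each axiom are the same polynomial in
  the values of the games involved.\<close>

lemma operad_games: "operad games"
proof (rule operad.intro)
  show "vec_space (component games n)" for n
    by (rule vec_space_games)
  show "lin_map (component games n) (component games n) (act games n \<sigma>)"
    if "\<sigma> permutes {1..n}" for n \<sigma>
  proof -
    show ?thesis using permutes_vimage_subset_iff[OF that]
      by (simp only: lin_map_def games_simps mem_Collect_eq Pi_iff) auto
  qed
  show "act games n id x = x" for n x by simp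
  show "act games n (\<sigma> \<circ> \<tau>) x = act games n \<sigma> (act games n \<tau> x)" for n \<sigma> \<tau> x
    by (simp add: vimage_comp[symmetric])
  show "lin_map (component games m) (component games (m + n - 1)) (\<lambda>x. pcomp games m n i x y)"
    if "i \<in> {1..m}" "y \<in> elts games n" for i m n y
  proof -
    have "(\<lambda>x. game_pcomp m n i x y) \<in> elts games m \<rightarrow> elts games (m + n - 1)"
      using game_pcomp_closed that by blast
    then show ?thesis
      by (simp only: lin_map_def games_simps(3,4,6) game_pcomp_linear) blast
  qed
  show "lin_map (component games n) (component games (m + n - 1)) (pcomp games m n i x)"
    if "i \<in> {1..m}" "x \<in> elts games m" for i m n x
  proof -
    have "(\<lambda>y. game_pcomp m n i x y) \<in> elts games n \<rightarrow> elts games (m + n - 1)"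
      using game_pcomp_closed that by blast
    then show ?thesis
      by (simp only: lin_map_def games_simps(3,4,6) game_pcomp_linear) blast
  qed
  show "pcomp games (l + m - 1) n (i + j - 1) (pcomp games l m i x y) z
      = pcomp games l (m + n - 1) i x (pcomp games m n j y z)"
    if h: "i \<in> {1..l}" "j \<in> {1..m}" "x \<in> elts games l" "y \<in> elts games m" "z \<in> elts games n"
    for i l j m n x y z
  proof
    fix S
    have N: "l + m - 1 + n - 1 = l + (m + n - 1) - 1" using h by auto
    show "pcomp games (l + m - 1) n (i + j - 1) (pcomp games l m i x y) z S
        = pcomp games l (m + n - 1) i x (pcomp games m n j y z) S"
    proof (cases "S \<subseteq> {1..l + m - 1 + n - 1}")
      case True
      let ?ij = "i + j - 1"
      let ?X = "outer_part l (m + n - 1) i S" and ?YZ = "inner_part (m + n - 1) i S"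
      let ?XY = "outer_part (l + m - 1) n ?ij S"
      have i: "i \<ge> 1" using h(1) by simp
      have sub: "?XY \<subseteq> {1..l + m - 1}" "insert ?ij ?XY \<subseteq> {1..l + m - 1}" "?YZ \<subseteq> {1..m + n - 1}"
        using h(1,2) by (auto simp: outer_part_def inner_part_def)
      show ?thesis
        unfolding games_simps game_pcomp_parts[OF True] game_pcomp_parts[OF True[unfolded N]]
          game_pcomp_grand[OF h(2,4,5)] game_pcomp_parts[OF sub(1)] game_pcomp_parts[OF sub(2)]
          game_pcomp_parts[OF sub(3)] inner_part_nested_inner[OF h(1,2)]
          outer_part_nested_inner[OF h(1,2)] outer_part_nested_outer[OF h(1,2)]
          inner_part_insert_inner[OF h(2) i] outer_part_insert_inner[OF h(2) i]
        by (simp only: ring_distribs mult_ac left_diff_distrib right_diff_distrib)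
    next
      case False
      then show ?thesis using N by (simp add: game_pcomp_outside del: One_nat_def)
    qed
  qed
  show "pcomp games (l + m - 1) n (k + m - 1) (pcomp games l m i x y) z
      = pcomp games (l + n - 1) m i (pcomp games l n k x z) y"
    if h: "i \<in> {1..l}" "k \<in> {1..l}" "i < k" "x \<in> elts games l" "y \<in> elts games m" "z \<in> elts games n"
    for i l k m n x y z
  proof
    fix S
    have N: "l + m - 1 + n - 1 = l + n - 1 + m - 1" using h by auto
    show "pcomp games (l + m - 1) n (k + m - 1) (pcomp games l m i x y) z S
        = pcomp games (l + n - 1) m i (pcomp games l n k x z) y S"
    proof (cases "S \<subseteq> {1..l + m - 1 + n - 1}")
      case True
      let ?p = "k + m - 1"
      let ?XY = "outer_part (l + m - 1) n ?p S" and ?XZ = "outer_part (l + n - 1) m i S"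
      let ?X = "outer_part l n k ?XZ"
      have p: "outer_pos m i k = ?p" "outer_pos n k i = i"
        using h(3) by (auto simp: outer_pos_def)
      have sub: "?XY \<subseteq> {1..l + m - 1}" "insert ?p ?XY \<subseteq> {1..l + m - 1}"
        "?XZ \<subseteq> {1..l + n - 1}" "insert i ?XZ \<subseteq> {1..l + n - 1}"
        using h(1-3) by (auto simp: outer_part_def)
      have ins: "inner_part m i (insert ?p ?XY) = inner_part m i S"
        "inner_part n k (insert i ?XZ) = inner_part n ?p S"
        "outer_part l m i (insert ?p ?XY) = insert k ?X"
        "outer_part l n k (insert i ?XZ) = insert i ?X"
        using inner_part_insert_outer[of k i m ?XY] inner_part_insert_outer[of i k n ?XZ]
          outer_part_insert_outer[of k l i m ?XY] outer_part_insert_outer[of i l k n ?XZ] h(1-3)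
          inner_part_outer_part_before[OF h(1-3)] inner_part_outer_part_after[OF h(1-3)]
          outer_part_outer_part[OF h(1-3)] unfolding p by auto
      show ?thesis
        unfolding games_simps game_pcomp_parts[OF True] game_pcomp_parts[OF True[unfolded N]]
          game_pcomp_parts[OF sub(1)] game_pcomp_parts[OF sub(2)]
          game_pcomp_parts[OF sub(3)] game_pcomp_parts[OF sub(4)] ins
          inner_part_outer_part_before[OF h(1-3)] inner_part_outer_part_after[OF h(1-3)]
          outer_part_outer_part[OF h(1-3)] insert_commute[of k i]
        by (simp only: ring_distribs mult_ac left_diff_distrib right_diff_distrib)
    next
      case False
      then show ?thesis using N by (simp add: game_pcomp_outside del: One_nat_def)
    qed
  qed
  show "opunit games \<in> elts games 1" by auto
  have opunit_eq: "opunit games {1} = 1" "opunit games {} = 0" by simp_all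
  show "pcomp games 1 n 1 (opunit games) x = x" if x: "x \<in> elts games n" for n x
  proof
    fix S
    have N: "1 + n - 1 = n" by simp
    have [simp]: "outer_part 1 n 1 S = {}" by (auto simp: outer_part_def)
    have "x {} = 0" using x by simp
    show "pcomp games 1 n 1 (opunit games) x S = x S"
    proof (cases "S \<subseteq> {1..n}")
      case True
      then have "inner_part n 1 S = S"
        by (auto simp: inner_part_def inner_pos_def)
      then show ?thesis
        using game_pcomp_parts[of S 1 n] True opunit_eq by (simp only: N games_simps(6)) (simp del: One_nat_def games_simps)
    next
      case False
      then show ?thesis
        using game_pcomp_outside[of S 1 n] x by (simp only: N games_simps(1,6)) simp
    qed
  qed
  show "pcomp games n 1 i x (opunit games) = x" if i: "i \<in> {1..n}" and x: "x \<in> elts games n" for i n x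
  proof
    fix S
    have N: "n + 1 - 1 = n" by simp
    have inner: "inner_part 1 i S = (if i \<in> S then {1} else {})"
      by (auto simp: inner_part_def inner_pos_def)
    show "pcomp games n 1 i x (opunit games) S = x S"
    proof (cases "S \<subseteq> {1..n}")
      case True
      then have "outer_part n 1 i S = S - {i}"
        by (auto simp: outer_part_def outer_pos_def)
      then show ?thesis
        using game_pcomp_parts[of S n 1] True opunit_eq inner
        by (simp only: N games_simps(6)) (simp add: insert_absorb del: One_nat_def games_simps)
    next
      case False
      then show ?thesis
        using game_pcomp_outside[of S n 1] x by (simp only: N games_simps(1,6)) simp
    qed
  qed
  show "pcomp games m n (\<sigma> i) (act games m \<sigma> x) (act games n \<tau> y)
      = act games (m + n - 1) (perm_pcomp n i \<sigma> \<tau>) (pcomp games m n i x y)"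
    if h: "i \<in> {1..m}" "\<sigma> permutes {1..m}" "\<tau> permutes {1..n}"
    for i m n \<sigma> \<tau> x y
  proof
    fix S
    let ?\<pi> = "perm_pcomp n i \<sigma> \<tau>"
    have \<pi>: "?\<pi> permutes {1..m + n - 1}" by (rule perm_pcomp_permutes[OF h])
    have sub: "?\<pi> -` S \<subseteq> {1..m + n - 1} \<longleftrightarrow> S \<subseteq> {1..m + n - 1}"
      by (rule permutes_vimage_subset_iff[OF \<pi>])
    have \<sigma>: "\<sigma> j \<in> {1..m} \<longleftrightarrow> j \<in> {1..m}" "\<sigma> j = \<sigma> i \<longleftrightarrow> j = i" for j
      using permutes_in_image[OF h(2)] permutes_inj[OF h(2)] by (auto simp: inj_eq)
    have \<tau>: "\<tau> k \<in> {1..n} \<longleftrightarrow> k \<in> {1..n}" for k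
      using permutes_in_image[OF h(3)] by auto
    have parts: "\<sigma> -` outer_part m n (\<sigma> i) S = outer_part m n i (?\<pi> -` S)"
      "\<tau> -` inner_part n (\<sigma> i) S = inner_part n i (?\<pi> -` S)"
      by (auto simp: outer_part_def inner_part_def perm_pcomp_inner perm_pcomp_outer \<sigma> \<tau>
          simp del: atLeastAtMost_iff One_nat_def)
    moreover have "\<sigma> -` insert (\<sigma> i) T = insert i (\<sigma> -` T)" for T
      using \<sigma>(2) by auto
    moreover have "\<tau> -` {1..n} = {1..n}" using \<tau> by blast
    ultimately show "pcomp games m n (\<sigma> i) (act games m \<sigma> x) (act games n \<tau> y) S
        = act games (m + n - 1) ?\<pi> (pcomp games m n i x y) S"
      by (cases "S \<subseteq> {1..m + n - 1}")
        (simp_all add: game_pcomp_parts game_pcomp_outside sub del: One_nat_def)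
  qed
qed

section \<open>Trees and their leading leaves\<close>
text \<open>The leaves that decide the value of the game of a tree: at a \<open>Nu\<close> vertex the first subtree
  dictates, at a \<open>Mu\<close> vertex both subtrees have to agree.\<close>

primrec leading :: "'l gen_tree \<Rightarrow> 'l set" where
  "leading (Leaf a) = {a}"
| "leading (Nu s t) = leading s"
| "leading (Mu u) = \<Union>(set_uprod (map_uprod leading u))"

text \<open>Structural induction in which the unordered pair at a \<open>Mu\<close> vertex is given by representatives.\<close>

lemma gen_tree_pair_induct [case_names Leaf Nu Mu]:
  assumes "\<And>a. P (Leaf a)" "\<And>s t. \<lbrakk>P s; P t\<rbrakk> \<Longrightarrow> P (Nu s t)"
    "\<And>s t. \<lbrakk>P s; P t\<rbrakk> \<Longrightarrow> P (Mu (Upair s t))"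
  shows "P t"
proof (induction t)
  case (Mu u)
  then show ?case by (cases u) (auto intro: assms(3))
qed (auto intro: assms)

lemma linear_Leaf [simp]: "linear_tree (Leaf a)"
  by (rule linear_tree.intros)

lemma linear_Nu [simp]:
  "linear_tree (Nu s t) \<longleftrightarrow>
     linear_tree s \<and> linear_tree t \<and> set_gen_tree s \<inter> set_gen_tree t = {}"
  by (auto intro: linear_tree.intros elim: linear_tree.cases)

lemma linear_Mu [simp]:
  "linear_tree (Mu (Upair s t)) \<longleftrightarrow>
     linear_tree s \<and> linear_tree t \<and> set_gen_tree s \<inter> set_gen_tree t = {}"
  (is "?l \<longleftrightarrow> ?r")
proof
  assume ?l
  then show ?r by cases auto
qed (auto intro: linear_tree.intros)

lemma finite_set_gen_tree [simp]: "finite (set_gen_tree t)"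
  by (induction t rule: gen_tree_pair_induct) auto

lemma leading_subset: "leading t \<subseteq> set_gen_tree t"
  by (induction t rule: gen_tree_pair_induct) auto

lemma leading_nonempty [simp]: "leading t \<noteq> {}"
  by (induction t rule: gen_tree_pair_induct) auto

lemma set_gen_tree_nonempty [simp]: "set_gen_tree t \<noteq> {}"
  using leading_subset[of t] leading_nonempty[of t] by blast

lemma leading_map [simp]: "leading (map_gen_tree f t) = f ` leading t"
  by (induction t rule: gen_tree_pair_induct) auto

lemma leading_subst [simp]: "leading (subst_tree h t) = (\<Union>j\<in>leading t. leading (h j))"
  by (induction t rule: gen_tree_pair_induct) auto

lemma set_subst [simp]: "set_gen_tree (subst_tree h t) = (\<Union>j\<in>set_gen_tree t. set_gen_tree (h j))"
  by (induction t rule: gen_tree_pair_induct) auto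

lemma subst_cong: "(\<And>j. j \<in> set_gen_tree t \<Longrightarrow> h j = h' j) \<Longrightarrow> subst_tree h t = subst_tree h' t"
  by (induction t rule: gen_tree_pair_induct) auto

lemma subst_map: "subst_tree h (map_gen_tree f t) = subst_tree (\<lambda>j. h (f j)) t"
  by (induction t rule: gen_tree_pair_induct) auto

lemma map_subst: "map_gen_tree f (subst_tree h t) = subst_tree (\<lambda>j. map_gen_tree f (h j)) t"
  by (induction t rule: gen_tree_pair_induct) auto

lemma subst_subst: "subst_tree g (subst_tree h t) = subst_tree (\<lambda>j. subst_tree g (h j)) t"
  by (induction t rule: gen_tree_pair_induct) auto

lemma linear_map: "\<lbrakk>linear_tree t; inj_on f (set_gen_tree t)\<rbrakk> \<Longrightarrow> linear_tree (map_gen_tree f t)"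
proof (induction t rule: gen_tree_pair_induct)
  case (Nu s t)
  then show ?case by (auto simp: gen_tree.set_map inj_on_Un inj_on_def)
next
  case (Mu s t)
  then show ?case by (auto simp: gen_tree.set_map inj_on_Un inj_on_def)
qed simp

lemma linear_subst:
  assumes "linear_tree t" "\<And>j. j \<in> set_gen_tree t \<Longrightarrow> linear_tree (h j)"
    "\<And>j k. \<lbrakk>j \<in> set_gen_tree t; k \<in> set_gen_tree t; j \<noteq> k\<rbrakk> \<Longrightarrow>
       set_gen_tree (h j) \<inter> set_gen_tree (h k) = {}"
  shows "linear_tree (subst_tree h t)"
  using assms
proof (induction t rule: gen_tree_pair_induct)
  case (Nu s t)
  then show ?case by (auto simp: disjoint_iff)
next
  case (Mu s t)
  then show ?case by (auto simp: disjoint_iff)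
qed simp

lemma trees_map:
  assumes "\<sigma> permutes {1..n}" "t \<in> trees n"
  shows "map_gen_tree \<sigma> t \<in> trees n"
  using assms permutes_image[OF assms(1)]
  by (auto simp: trees_def gen_tree.set_map intro!: linear_map permutes_inj_on simp del: One_nat_def)

lemma leading_trees: "t \<in> trees n \<Longrightarrow> leading t \<subseteq> {1..n}"
  using leading_subset[of t] by (simp add: trees_def)

lemma inner_outer_image:
  assumes i: "i \<in> {1..m}"
  shows "inner_pos i ` {1..n} \<union> outer_pos n i ` ({1..m} - {i}) = {1..m + n - 1}"
proof (intro equalityI subsetI)
  fix p assume "p \<in> {1..m + n - 1}"
  with i show "p \<in> inner_pos i ` {1..n} \<union> outer_pos n i ` ({1..m} - {i})"
    by (cases rule: pos_cases) blast+
qed (use inner_pos_in[OF i] outer_pos_in[OF i] in blast)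

lemma inj_on_inner_pos: "inj_on (inner_pos i) {1..n}"
  by (auto simp: inj_on_def inner_pos_def)

lemma graft_trees:
  assumes i: "i \<in> {1..m}" and s: "s \<in> trees m" and t: "t \<in> trees n"
  shows "graft n i s t \<in> trees (m + n - 1)"
proof -
  let ?h = "\<lambda>j. if j = i then map_gen_tree (inner_pos i) t else Leaf (outer_pos n i j)"
  have s: "linear_tree s" "set_gen_tree s = {1..m}" and t: "linear_tree t" "set_gen_tree t = {1..n}"
    using s t by (auto simp: trees_def)
  have "set_gen_tree (?h i) = inner_pos i ` {1..n}"
    by (simp add: gen_tree.set_map t(2))
  moreover have "(\<Union>j\<in>{1..m} - {i}. set_gen_tree (?h j)) = outer_pos n i ` ({1..m} - {i})"
    by auto
  moreover have "(\<Union>j\<in>{1..m}. set_gen_tree (?h j))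
      = set_gen_tree (?h i) \<union> (\<Union>j\<in>{1..m} - {i}. set_gen_tree (?h j))"
    using i by blast
  ultimately have "set_gen_tree (graft n i s t) = {1..m + n - 1}"
    using inner_outer_image[OF i, of n] unfolding graft_def set_subst s(2) by simp
  moreover have "linear_tree (graft n i s t)"
    unfolding graft_def
  proof (rule linear_subst[OF s(1)])
    fix j assume "j \<in> set_gen_tree s"
    show "linear_tree (?h j)"
      using linear_map[OF t(1), of "inner_pos i"] inj_on_inner_pos[of i n]
      unfolding t(2) by simp
  next
    fix j k assume "j \<in> set_gen_tree s" "k \<in> set_gen_tree s" "j \<noteq> k"
    then show "set_gen_tree (?h j) \<inter> set_gen_tree (?h k) = {}"
      using i outer_pos_neq_inner_pos[of _ n i] outer_pos_inj[of n i j k]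
      by (auto simp: gen_tree.set_map t(2))
  qed
  ultimately show ?thesis
    by (simp add: trees_def)
qed

definition unanimity :: "nat \<Rightarrow> nat set \<Rightarrow> game" where
  "unanimity n S T = (if S \<subseteq> T \<and> T \<subseteq> {1..n} then 1 else 0)"

lemma unanimity_closed: "S \<noteq> {} \<Longrightarrow> unanimity n S \<in> elts games n"
  by (auto simp: unanimity_def)

lemma unanimity_action:
  assumes "\<sigma> permutes {1..n}"
  shows "act games n \<sigma> (unanimity n S) = unanimity n (\<sigma> ` S)"
  using permutes_vimage_subset_iff[OF assms]
  by (auto simp: unanimity_def fun_eq_iff image_subset_iff_subset_vimage simp del: One_nat_def atLeastAtMost_iff)

text \<open>If \<open>i\<close> is not in \<open>S\<close>, it is a null player of the outer game and the derivative vanishes.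
  Otherwise the outer game has value \<open>0\<close> without \<open>i\<close>, so only the derivative term
  remains, and it asks for \<open>S - {i}\<close> and \<open>T\<close> at once.\<close>

lemma unanimity_pcomp:
  assumes i: "i \<in> {1..m}" and S: "S \<subseteq> {1..m}" and T: "T \<subseteq> {1..n}"
  shows "game_pcomp m n i (unanimity m S) (unanimity n T)
    = unanimity (m + n - 1)
        (\<Union>j\<in>S. if j = i then inner_pos i ` T else {outer_pos n i j})" (is "_ = unanimity _ ?U")
proof
  fix R
  show "game_pcomp m n i (unanimity m S) (unanimity n T) R = unanimity (m + n - 1) ?U R"
  proof (cases "R \<subseteq> {1..m + n - 1}")
    case True
    let ?X = "outer_part m n i R" and ?Y = "inner_part n i R"
    have sub: "?X \<subseteq> {1..m}" "insert i ?X \<subseteq> {1..m}" "?Y \<subseteq> {1..n}"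
      using i by (auto simp: outer_part_def inner_part_def)
    have X: "S \<subseteq> insert i ?X \<longleftrightarrow> outer_pos n i ` (S - {i}) \<subseteq> R"
      "S \<subseteq> ?X \<longleftrightarrow> i \<notin> S \<and> outer_pos n i ` (S - {i}) \<subseteq> R"
      using S by (auto simp: outer_part_def)
    have Y: "T \<subseteq> ?Y \<longleftrightarrow> inner_pos i ` T \<subseteq> R"
      using T by (auto simp: inner_part_def)
    have U: "?U \<subseteq> R \<longleftrightarrow> outer_pos n i ` (S - {i}) \<subseteq> R \<and> (i \<in> S \<longrightarrow> inner_pos i ` T \<subseteq> R)"
      by (auto split: if_splits)
    show ?thesis
      unfolding game_pcomp_parts[OF True] unanimity_def U using True sub X Y T
      by (cases "i \<in> S") (simp_all del: One_nat_def)
  qed (simp add: game_pcomp_outside unanimity_def del: One_nat_def)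
qed

text \<open>Grafting trees acts on leading leaves in the way that composition acts on unanimity games; this
  is why sending a tree to the unanimity game of its leading leaves respects composition.\<close>

lemma unanimity_pcomp_leading:
  assumes "i \<in> {1..m}" "s \<in> trees m" "t \<in> trees n"
  shows "game_pcomp m n i (unanimity m (leading s)) (unanimity n (leading t))
    = unanimity (m + n - 1) (leading (graft n i s t))"
proof -
  have "leading (graft n i s t)
      = (\<Union>j\<in>leading s. if j = i then inner_pos i ` leading t else {outer_pos n i j})"
    unfolding graft_def leading_subst by (intro SUP_cong) auto
  then show ?thesis
    using assms by (simp add: unanimity_pcomp leading_trees del: One_nat_def)
qed

section \<open>Evaluation of free operations as games\<close>
lemma lookup_scale [simp]:
  "Poly_Mapping.lookup (Poly_Mapping.map ((*) r) f) t = r * Poly_Mapping.lookup f (t :: 'b)"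
  for r :: real
  by (simp add: Poly_Mapping.map.rep_eq when_def)

lemma free_simps [simp]:
  "elts free_operad n = {f. \<forall>t. t \<notin> trees n \<longrightarrow> Poly_Mapping.lookup f t = 0}"
  "\<zero>\<^bsub>component free_operad n\<^esub> = 0"
  "f \<oplus>\<^bsub>component free_operad n\<^esub> g = f + g"
  "r \<odot>\<^bsub>component free_operad n\<^esub> f = Poly_Mapping.map ((*) r) f"
  "opunit free_operad = Poly_Mapping.single (Leaf 1) 1"
  by (auto simp: free_operad_def in_keys_iff)

lemma vec_space_free: "vec_space (component free_operad n)"
proof (intro moduleI cring_real_ring abelian_groupI)
  fix f assume "f \<in> elts free_operad n"
  then show "\<exists>g\<in>elts free_operad n. g \<oplus>\<^bsub>component free_operad n\<^esub> f = \<zero>\<^bsub>component free_operad n\<^esub>"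
    by (intro bexI[of _ "- f"]) auto
qed (auto simp: lookup_add algebra_simps intro!: poly_mapping_eqI)

text \<open>The sums over keys that define the free operations may be taken over any larger finite set; with a
  common index set linearity becomes a termwise statement.\<close>

lemma act_free_sum:
  assumes "finite A" "Poly_Mapping.keys f \<subseteq> A"
  shows "act free_operad n \<sigma> f
    = (\<Sum>t\<in>A. Poly_Mapping.single (map_gen_tree \<sigma> t) (Poly_Mapping.lookup f t))"
  unfolding free_operad_def using assms
  by (auto intro!: sum.mono_neutral_left simp: in_keys_iff)

lemma pcomp_free_sum:
  assumes "finite A" "Poly_Mapping.keys f \<subseteq> A" "finite B" "Poly_Mapping.keys g \<subseteq> B"
  shows "pcomp free_operad m n i f g = (\<Sum>s\<in>A. \<Sum>t\<in>B.
    Poly_Mapping.single (graft n i s t) (Poly_Mapping.lookup f s * Poly_Mapping.lookup g t))"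
proof -
  have "pcomp free_operad m n i f g = (\<Sum>s\<in>Poly_Mapping.keys f. \<Sum>t\<in>B.
      Poly_Mapping.single (graft n i s t) (Poly_Mapping.lookup f s * Poly_Mapping.lookup g t))"
    unfolding free_operad_def using assms
    by (simp, intro sum.cong[OF refl] sum.mono_neutral_left) (auto simp: in_keys_iff)
  also have "\<dots> = (\<Sum>s\<in>A. \<Sum>t\<in>B.
      Poly_Mapping.single (graft n i s t) (Poly_Mapping.lookup f s * Poly_Mapping.lookup g t))"
    using assms by (intro sum.mono_neutral_left) (auto simp: in_keys_iff)
  finally show ?thesis .
qed

lemma act_free_single:
  "act free_operad n \<sigma> (Poly_Mapping.single t r) = Poly_Mapping.single (map_gen_tree \<sigma> t) r"
  by (subst act_free_sum[of "{t}"]) auto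

lemma act_free_diff:
  "act free_operad n \<sigma> (f - g) = act free_operad n \<sigma> f - act free_operad n \<sigma> g"
proof -
  let ?A = "Poly_Mapping.keys f \<union> Poly_Mapping.keys g"
  have "Poly_Mapping.keys (f - g) \<subseteq> ?A"
    by (auto simp: in_keys_iff lookup_minus)
  then show ?thesis
    by (simp add: act_free_sum[of ?A] lookup_minus single_diff sum_subtractf)
qed

lemma pcomp_free_single:
  "pcomp free_operad m n i (Poly_Mapping.single s a) (Poly_Mapping.single t b)
    = Poly_Mapping.single (graft n i s t) (a * b)"
  by (subst pcomp_free_sum[of "{s}" _ "{t}"]) auto

lemma pcomp_free_diff_left:
  "pcomp free_operad m n i (f - f') g = pcomp free_operad m n i f g - pcomp free_operad m n i f' g"
proof -
  let ?A = "Poly_Mapping.keys f \<union> Poly_Mapping.keys f'"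
  have "Poly_Mapping.keys (f - f') \<subseteq> ?A"
    by (auto simp: in_keys_iff lookup_minus)
  then show ?thesis
    by (simp add: pcomp_free_sum[of ?A _ "Poly_Mapping.keys g"] lookup_minus left_diff_distrib
        single_diff sum_subtractf)
qed

lemma pcomp_free_diff_right:
  "pcomp free_operad m n i f (g - g') = pcomp free_operad m n i f g - pcomp free_operad m n i f g'"
proof -
  let ?B = "Poly_Mapping.keys g \<union> Poly_Mapping.keys g'"
  have "Poly_Mapping.keys (g - g') \<subseteq> ?B"
    by (auto simp: in_keys_iff lookup_minus)
  then show ?thesis
    by (simp add: pcomp_free_sum[of "Poly_Mapping.keys f" _ ?B] lookup_minus right_diff_distrib
        single_diff sum_subtractf)
qed

lemma keys_elts: "f \<in> elts free_operad n \<Longrightarrow> Poly_Mapping.keys f \<subseteq> trees n"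
  by (auto simp: in_keys_iff)

lemma single_elts: "t \<in> trees n \<Longrightarrow> Poly_Mapping.single t r \<in> elts free_operad n"
  by (auto simp: lookup_single when_def)

lemma sum_elts: "(\<And>a. a \<in> A \<Longrightarrow> g a \<in> elts free_operad n) \<Longrightarrow> sum g A \<in> elts free_operad n"
  by (auto simp: lookup_sum intro!: sum.neutral)

lemma act_free_closed:
  assumes "\<sigma> permutes {1..n}" "f \<in> elts free_operad n"
  shows "act free_operad n \<sigma> f \<in> elts free_operad n"
  unfolding act_free_sum[OF finite_keys subset_refl]
  using trees_map[OF assms(1)] keys_elts[OF assms(2)] by (intro sum_elts single_elts) blast

lemma pcomp_free_closed:
  assumes "i \<in> {1..m}" "f \<in> elts free_operad m" "g \<in> elts free_operad n"
  shows "pcomp free_operad m n i f g \<in> elts free_operad (m + n - 1)"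
  unfolding pcomp_free_sum[OF finite_keys subset_refl finite_keys subset_refl]
  using graft_trees[OF assms(1)] keys_elts[OF assms(2)] keys_elts[OF assms(3)]
  by (intro sum_elts single_elts) blast

text \<open>The linear extension of the map that sends a tree to the unanimity game of its leading leaves.\<close>

definition free_eval :: "nat \<Rightarrow> (nat gen_tree \<Rightarrow>\<^sub>0 real) \<Rightarrow> game" where
  "free_eval n f R =
     (\<Sum>t\<in>Poly_Mapping.keys f. Poly_Mapping.lookup f t * unanimity n (leading t) R)"

lemma free_eval_sum_superset:
  assumes "finite A" "Poly_Mapping.keys f \<subseteq> A"
  shows "free_eval n f R = (\<Sum>t\<in>A. Poly_Mapping.lookup f t * unanimity n (leading t) R)"
  unfolding free_eval_def using assms by (intro sum.mono_neutral_left) (auto simp: in_keys_iff)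

lemma free_eval_single [simp]:
  "free_eval n (Poly_Mapping.single t r) = (\<lambda>R. r * unanimity n (leading t) R)"
  by (subst fun_eq_iff) (simp add: free_eval_sum_superset[of "{t}"])

lemma free_eval_add [simp]: "free_eval n (f + g) = (\<lambda>R. free_eval n f R + free_eval n g R)"
proof
  fix R
  show "free_eval n (f + g) R = free_eval n f R + free_eval n g R"
    using keys_add[of f g]
    by (simp add: free_eval_sum_superset[of "Poly_Mapping.keys f \<union> Poly_Mapping.keys g"]
        lookup_add distrib_right sum.distrib)
qed

lemma free_eval_scale [simp]:
  "free_eval n (Poly_Mapping.map ((*) r) f) = (\<lambda>R. r * free_eval n f R)"
proof
  fix R
  have "Poly_Mapping.keys (Poly_Mapping.map ((*) r) f) \<subseteq> Poly_Mapping.keys f"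
    by (auto simp: in_keys_iff)
  then show "free_eval n (Poly_Mapping.map ((*) r) f) R = r * free_eval n f R"
    by (simp add: free_eval_sum_superset[of "Poly_Mapping.keys f"] sum_distrib_left mult.assoc)
qed

lemma free_eval_zero [simp]: "free_eval n 0 = (\<lambda>R. 0)"
  by (simp add: free_eval_def fun_eq_iff)

lemma free_eval_diff [simp]: "free_eval n (f - g) = (\<lambda>R. free_eval n f R - free_eval n g R)"
  using free_eval_add[of n "f - g" g] by (auto simp: fun_eq_iff)

lemma free_eval_sum: "free_eval n (sum g A) = (\<lambda>R. \<Sum>a\<in>A. free_eval n (g a) R)"
  by (induction A rule: infinite_finite_induct) auto

lemma free_eval_closed: "free_eval n f \<in> elts games n"
  using unanimity_closed[of "leading _" n] by (auto simp: free_eval_def intro!: sum.neutral)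

lemma free_eval_act:
  assumes "\<sigma> permutes {1..n}"
  shows "free_eval n (act free_operad n \<sigma> f) = act games n \<sigma> (free_eval n f)"
proof -
  have "unanimity n (\<sigma> ` S) R = unanimity n S (\<sigma> -` R)" for S R
    using fun_cong[OF unanimity_action[OF assms, of S], of R] by simp
  then show ?thesis
    by (simp add: act_free_sum[OF finite_keys subset_refl] free_eval_sum
        free_eval_def[of n f, abs_def])
qed

lemma game_pcomp_zero:
  "game_pcomp m n i (\<lambda>S. 0) \<beta> = (\<lambda>S. 0)" "game_pcomp m n i \<alpha> (\<lambda>S. 0) = (\<lambda>S. 0)"
  by (simp_all add: game_pcomp_def game_deriv_def fun_eq_iff)

lemma game_pcomp_sum_left:
  "game_pcomp m n i (\<lambda>S. \<Sum>a\<in>A. c a * \<alpha> a S) \<beta> = (\<lambda>S. \<Sum>a\<in>A. c a * game_pcomp m n i (\<alpha> a) \<beta> S)"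
  by (induction A rule: infinite_finite_induct) (simp_all add: game_pcomp_zero game_pcomp_linear)

lemma game_pcomp_sum_right:
  "game_pcomp m n i \<alpha> (\<lambda>S. \<Sum>b\<in>B. c b * \<beta> b S) = (\<lambda>S. \<Sum>b\<in>B. c b * game_pcomp m n i \<alpha> (\<beta> b) S)"
  by (induction B rule: infinite_finite_induct) (simp_all add: game_pcomp_zero game_pcomp_linear)

lemma free_eval_pcomp:
  assumes i: "i \<in> {1..m}" and f: "f \<in> elts free_operad m" and g: "g \<in> elts free_operad n"
  shows "free_eval (m + n - 1) (pcomp free_operad m n i f g)
    = pcomp games m n i (free_eval m f) (free_eval n g)"
proof -
  have "game_pcomp m n i (free_eval m f) (free_eval n g) = (\<lambda>R.
      \<Sum>s\<in>Poly_Mapping.keys f. \<Sum>t\<in>Poly_Mapping.keys g.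
        Poly_Mapping.lookup f s * Poly_Mapping.lookup g t
          * game_pcomp m n i (unanimity m (leading s)) (unanimity n (leading t)) R)"
    by (simp add: free_eval_def[abs_def] game_pcomp_sum_left game_pcomp_sum_right
        sum_distrib_left mult.assoc)
  also have "\<dots> = (\<lambda>R. \<Sum>s\<in>Poly_Mapping.keys f. \<Sum>t\<in>Poly_Mapping.keys g.
        Poly_Mapping.lookup f s * Poly_Mapping.lookup g t
          * unanimity (m + n - 1) (leading (graft n i s t)) R)"
  proof (intro ext sum.cong refl)
    fix R s t assume "s \<in> Poly_Mapping.keys f" "t \<in> Poly_Mapping.keys g"
    then have "s \<in> trees m" "t \<in> trees n"
      using keys_elts[OF f] keys_elts[OF g] by auto
    then show "Poly_Mapping.lookup f s * Poly_Mapping.lookup g t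
          * game_pcomp m n i (unanimity m (leading s)) (unanimity n (leading t)) R
        = Poly_Mapping.lookup f s * Poly_Mapping.lookup g t
          * unanimity (m + n - 1) (leading (graft n i s t)) R"
      by (simp only: unanimity_pcomp_leading[OF i])
  qed
  finally show ?thesis
    by (simp add: pcomp_free_sum[OF finite_keys subset_refl finite_keys subset_refl]
        free_eval_sum del: One_nat_def)
qed

definition eval_kernel :: "nat \<Rightarrow> (nat gen_tree \<Rightarrow>\<^sub>0 real) set" where
  "eval_kernel n = {f \<in> elts free_operad n. free_eval n f = (\<lambda>R. 0)}"

text \<open>The kernel of a map that respects all operations.\<close>

lemma operadic_ideal_eval_kernel: "operadic_ideal free_operad eval_kernel"
  unfolding operadic_ideal_def
proof (intro conjI allI ballI impI)
  fix n
  interpret module real_ring "component free_operad n" by (rule vec_space_free)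
  show "submodule (eval_kernel n) real_ring (component free_operad n)"
  proof (rule submoduleI)
    fix f assume f: "f \<in> eval_kernel n"
    then have "f \<in> elts free_operad n" by (simp add: eval_kernel_def)
    then have "\<ominus>\<^bsub>component free_operad n\<^esub> f = Poly_Mapping.map ((*) (-1)) f"
      by (intro M.minus_equality) (auto intro!: poly_mapping_eqI simp: lookup_add)
    with f show "\<ominus>\<^bsub>component free_operad n\<^esub> f \<in> eval_kernel n"
      by (simp add: eval_kernel_def)
  qed (auto simp: eval_kernel_def lookup_add)
next
  fix n \<sigma> f assume "\<sigma> permutes {1..n}" "f \<in> eval_kernel n"
  then show "act free_operad n \<sigma> f \<in> eval_kernel n"
    using act_free_closed[of \<sigma> n f] by (simp add: eval_kernel_def free_eval_act del: free_simps(1))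
next
  fix m n i f g assume "i \<in> {1..m}" "f \<in> eval_kernel m" "g \<in> elts free_operad n"
  then show "pcomp free_operad m n i f g \<in> eval_kernel (m + n - 1)"
    using pcomp_free_closed[of i m f g n]
    by (simp add: eval_kernel_def free_eval_pcomp game_pcomp_zero del: free_simps(1) One_nat_def)
next
  fix m n i f g assume "i \<in> {1..m}" "f \<in> elts free_operad m" "g \<in> eval_kernel n"
  then show "pcomp free_operad m n i f g \<in> eval_kernel (m + n - 1)"
    using pcomp_free_closed[of i m f g n]
    by (simp add: eval_kernel_def free_eval_pcomp game_pcomp_zero del: free_simps(1) One_nat_def)
qed

text \<open>The relators as pairs of trees, in the order in which they are listed in \<open>com_triass_relators\<close>.\<close>

definition defining_relations :: "(nat gen_tree \<times> nat gen_tree) set" where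
  "defining_relations =
     (let a = Leaf 1; b = Leaf 2; c = Leaf 3; mu = (\<lambda>s t. Mu (Upair s t)) in
      {(mu (mu a b) c, mu a (mu b c)),
       (Nu (Nu a b) c, Nu a (Nu b c)),
       (Nu a (Nu b c), Nu a (Nu c b)),
       (Nu a (mu b c), Nu a (Nu b c)),
       (Nu (mu a b) c, mu a (Nu b c))})"

lemma com_triass_relators_eq:
  "com_triass_relators n =
    (if n = 3 then (\<lambda>(s, t). Poly_Mapping.single s 1 - Poly_Mapping.single t 1) ` defining_relations
     else {})"
  by (simp add: com_triass_relators_def free_nu_def free_mu_def pcomp_free_single act_free_single
      defining_relations_def graft_def inner_pos_def outer_pos_def Let_def numeral_eq_Suc
      transpose_apply_first transpose_apply_second)

lemma defining_relations_props:
  assumes "(s, t) \<in> defining_relations"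
  shows "s \<in> trees 3" "t \<in> trees 3" "leading s = leading t"
  using assms by (auto simp: defining_relations_def Let_def trees_def)

lemma com_triass_relators_kernel: "com_triass_relators n \<subseteq> eval_kernel n"
  using defining_relations_props single_elts[of _ 3 1]
  by (auto simp: com_triass_relators_eq eval_kernel_def lookup_minus fun_eq_iff)

lemma com_triass_ideal_subset: "com_triass_ideal n \<subseteq> eval_kernel n"
  unfolding com_triass_ideal_def ideal_generated_def
  using operadic_ideal_eval_kernel com_triass_relators_kernel by blast

lemma com_triass_ideal_iff:
  "f \<in> com_triass_ideal n \<longleftrightarrow>
    (\<forall>I. operadic_ideal free_operad I \<longrightarrow> (\<forall>k. com_triass_relators k \<subseteq> I k) \<longrightarrow> f \<in> I n)"
  unfolding com_triass_ideal_def ideal_generated_def by blast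

lemma operadic_ideal_closed:
  assumes "operadic_ideal free_operad I"
  shows "0 \<in> I n" "\<lbrakk>f \<in> I n; g \<in> I n\<rbrakk> \<Longrightarrow> f + g \<in> I n"
    "f \<in> I n \<Longrightarrow> Poly_Mapping.map ((*) r) f \<in> I n"
    "\<lbrakk>\<sigma> permutes {1..n}; f \<in> I n\<rbrakk> \<Longrightarrow> act free_operad n \<sigma> f \<in> I n"
    "\<lbrakk>i \<in> {1..m}; f \<in> I m; g \<in> elts free_operad n\<rbrakk> \<Longrightarrow> pcomp free_operad m n i f g \<in> I (m + n - 1)"
    "\<lbrakk>i \<in> {1..m}; f \<in> elts free_operad m; g \<in> I n\<rbrakk> \<Longrightarrow> pcomp free_operad m n i f g \<in> I (m + n - 1)"
proof -
  have sub: "submodule (I n) real_ring (component free_operad n)" for n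
    using assms unfolding operadic_ideal_def by blast
  interpret submodule "I n" real_ring "component free_operad n" by (rule sub)
  show "0 \<in> I n" "\<lbrakk>f \<in> I n; g \<in> I n\<rbrakk> \<Longrightarrow> f + g \<in> I n"
    "f \<in> I n \<Longrightarrow> Poly_Mapping.map ((*) r) f \<in> I n"
    using one_closed m_closed[of f g] smult_closed[of r f] by simp_all
qed (use assms in \<open>unfold operadic_ideal_def, blast+\<close>)

text \<open>Each closure property of operadic ideals passes to their intersection.\<close>

lemma com_triass_ideal_closed:
  "0 \<in> com_triass_ideal n"
  "\<lbrakk>f \<in> com_triass_ideal n; g \<in> com_triass_ideal n\<rbrakk> \<Longrightarrow> f + g \<in> com_triass_ideal n"
  "f \<in> com_triass_ideal n \<Longrightarrow> Poly_Mapping.map ((*) r) f \<in> com_triass_ideal n"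
  "\<lbrakk>\<sigma> permutes {1..n}; f \<in> com_triass_ideal n\<rbrakk> \<Longrightarrow> act free_operad n \<sigma> f \<in> com_triass_ideal n"
  "\<lbrakk>i \<in> {1..m}; f \<in> com_triass_ideal m; g \<in> elts free_operad n\<rbrakk> \<Longrightarrow>
    pcomp free_operad m n i f g \<in> com_triass_ideal (m + n - 1)"
  "\<lbrakk>i \<in> {1..m}; f \<in> elts free_operad m; g \<in> com_triass_ideal n\<rbrakk> \<Longrightarrow>
    pcomp free_operad m n i f g \<in> com_triass_ideal (m + n - 1)"
  unfolding com_triass_ideal_iff by (meson operadic_ideal_closed)+

lemma defining_relations_ideal:
  "(s, t) \<in> defining_relations \<Longrightarrow>
    Poly_Mapping.single s 1 - Poly_Mapping.single t 1 \<in> com_triass_ideal 3"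
  unfolding com_triass_ideal_iff com_triass_relators_eq by fastforce

section \<open>Congruence of trees modulo the ideal\<close>
text \<open>Congruence modulo the ideal for trees with arbitrary labels, tested on standard relabellings by
  \<open>[n]\<close>. Free labels let one speak about subtrees without renumbering them, so that the relations
  can be applied inside larger trees.\<close>

definition tree_cong :: "nat gen_tree \<Rightarrow> nat gen_tree \<Rightarrow> bool" (infix "\<approx>" 50) where
  "s \<approx> t \<longleftrightarrow> linear_tree s \<and> linear_tree t \<and> set_gen_tree s = set_gen_tree t \<and>
     (\<forall>\<rho>. bij_betw \<rho> (set_gen_tree s) {1..card (set_gen_tree s)} \<longrightarrow>
       Poly_Mapping.single (map_gen_tree \<rho> s) 1 - Poly_Mapping.single (map_gen_tree \<rho> t) 1
         \<in> com_triass_ideal (card (set_gen_tree s)))"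

text \<open>A single relabelling suffices, because any two differ by a permutation and the ideal is invariant
  under permutations.\<close>

lemma tree_congI:
  assumes s: "linear_tree s" "set_gen_tree s = A" and t: "linear_tree t" "set_gen_tree t = A"
    and \<rho>: "bij_betw \<rho> A {1..card A}"
    and ideal: "Poly_Mapping.single (map_gen_tree \<rho> s) 1 - Poly_Mapping.single (map_gen_tree \<rho> t) 1
      \<in> com_triass_ideal (card A)"
  shows "s \<approx> t"
proof -
  let ?n = "card A"
  have "Poly_Mapping.single (map_gen_tree \<rho>' s) 1 - Poly_Mapping.single (map_gen_tree \<rho>' t) 1
      \<in> com_triass_ideal ?n" if \<rho>': "bij_betw \<rho>' A {1..?n}" for \<rho>'
  proof -
    \<comment> \<open>the permutation of \<open>[n]\<close> that turns \<open>\<rho>\<close> into \<open>\<rho>'\<close>\<close>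
    define \<sigma> where "\<sigma> k = (if k \<in> {1..?n} then \<rho>' (inv_into A \<rho> k) else k)" for k
    have "bij_betw (\<rho>' \<circ> inv_into A \<rho>) {1..?n} {1..?n}"
      using bij_betw_trans[OF bij_betw_inv_into[OF \<rho>] \<rho>'] .
    then have "bij_betw \<sigma> {1..?n} {1..?n}"
      by (rule bij_betw_cong[THEN iffD1, rotated]) (simp add: \<sigma>_def)
    then have \<sigma>: "\<sigma> permutes {1..?n}"
      by (rule bij_imp_permutes) (auto simp: \<sigma>_def)
    have "\<sigma> (\<rho> x) = \<rho>' x" if "x \<in> A" for x
      using \<rho> that by (auto simp: \<sigma>_def bij_betw_def)
    then have "map_gen_tree \<sigma> (map_gen_tree \<rho> s) = map_gen_tree \<rho>' s"
      "map_gen_tree \<sigma> (map_gen_tree \<rho> t) = map_gen_tree \<rho>' t"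
      using s t by (auto simp: gen_tree.map_comp intro!: gen_tree.map_cong0)
    then show ?thesis
      using com_triass_ideal_closed(4)[OF \<sigma> ideal] by (simp add: act_free_diff act_free_single)
  qed
  then show ?thesis
    using s t by (simp add: tree_cong_def)
qed

lemma tree_cong_refl: "linear_tree t \<Longrightarrow> t \<approx> t"
  by (simp add: tree_cong_def com_triass_ideal_closed(1))

lemma tree_cong_ideal:
  assumes "s \<approx> t" "bij_betw \<rho> (set_gen_tree s) {1..card (set_gen_tree s)}"
  shows "Poly_Mapping.single (map_gen_tree \<rho> s) 1 - Poly_Mapping.single (map_gen_tree \<rho> t) 1
    \<in> com_triass_ideal (card (set_gen_tree s))"
  using assms unfolding tree_cong_def by blast

lemma tree_cong_sym:
  assumes "s \<approx> t"
  shows "t \<approx> s"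
proof -
  have "g - f \<in> com_triass_ideal n" if "f - g \<in> com_triass_ideal n" for f g n
  proof -
    have "Poly_Mapping.map ((*) (-1)) (f - g) = g - f"
      by (rule poly_mapping_eqI) (simp add: lookup_minus)
    then show ?thesis
      using com_triass_ideal_closed(3)[OF that, of "-1"] by simp
  qed
  then show ?thesis
    using assms unfolding tree_cong_def by metis
qed

lemma tree_cong_trans [trans]:
  assumes "s \<approx> t" "t \<approx> u"
  shows "s \<approx> u"
  unfolding tree_cong_def
proof (intro conjI allI impI)
  let ?n = "card (set_gen_tree s)"
  fix \<rho> assume "bij_betw \<rho> (set_gen_tree s) {1..?n}"
  then have "(Poly_Mapping.single (map_gen_tree \<rho> s) 1 - Poly_Mapping.single (map_gen_tree \<rho> t) 1)
      + (Poly_Mapping.single (map_gen_tree \<rho> t) 1 - Poly_Mapping.single (map_gen_tree \<rho> u) 1)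
      \<in> com_triass_ideal ?n"
    using assms unfolding tree_cong_def by (intro com_triass_ideal_closed(2)) auto
  then show "Poly_Mapping.single (map_gen_tree \<rho> s) 1 - Poly_Mapping.single (map_gen_tree \<rho> u) 1
      \<in> com_triass_ideal ?n"
    by simp
qed (use assms in \<open>auto simp: tree_cong_def\<close>)

lemma tree_congD:
  assumes "s \<approx> t"
  shows "linear_tree s" "linear_tree t" "set_gen_tree t = set_gen_tree s"
  using assms by (auto simp: tree_cong_def)

lemma tree_cong_map:
  assumes "s \<approx> t" and f: "inj_on f (set_gen_tree s)"
  shows "map_gen_tree f s \<approx> map_gen_tree f t"
proof -
  note st = tree_congD[OF assms(1)]
  let ?A = "set_gen_tree s"
  obtain \<rho> where \<rho>: "bij_betw \<rho> (f ` ?A) {1..card (f ` ?A)}"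
    using ex_bij_betw_finite_nat[of "f ` ?A"] ex_bij_betw_nat_finite_1[of "f ` ?A"]
    by (meson bij_betw_inv finite_imageI finite_set_gen_tree)
  have card: "card (f ` ?A) = card ?A"
    using f by (rule card_image)
  have "bij_betw (\<rho> \<circ> f) ?A {1..card ?A}"
    using bij_betw_trans[OF inj_on_imp_bij_betw[OF f] \<rho>] card by simp
  then have "Poly_Mapping.single (map_gen_tree (\<rho> \<circ> f) s) 1
      - Poly_Mapping.single (map_gen_tree (\<rho> \<circ> f) t) 1 \<in> com_triass_ideal (card ?A)"
    by (rule tree_cong_ideal[OF assms(1)])
  then show ?thesis
    using st f by (intro tree_congI[OF _ _ _ _ \<rho>])
      (auto simp: gen_tree.set_map gen_tree.map_comp card intro: linear_map)
qed

lemma subst_id: "(\<And>j. j \<in> set_gen_tree t \<Longrightarrow> h j = Leaf j) \<Longrightarrow> subst_tree h t = t"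
  by (induction t rule: gen_tree_pair_induct) auto

lemma linear_subst_leaf:
  assumes "linear_tree u" "linear_tree t" "set_gen_tree t \<inter> (set_gen_tree u - {i}) = {}"
  shows "linear_tree (subst_tree (Leaf(i := t)) u)"
  using assms by (intro linear_subst) auto

lemma set_subst_leaf:
  assumes "i \<in> set_gen_tree u"
  shows "set_gen_tree (subst_tree (Leaf(i := t)) u) = set_gen_tree u - {i} \<union> set_gen_tree t"
  using assms by (auto split: if_splits)

text \<open>Substitution at a leaf is, up to relabelling, a partial composition. The relabelling depends only
  on the label sets, so the same one serves for all trees with these labels.\<close>

lemma subst_leaf_as_graft:
  assumes i: "i \<in> U" and disj: "A \<inter> (U - {i}) = {}" and fin: "finite U" "finite A"
    and \<rho>U: "bij_betw \<rho>U U {1..card U}" and \<rho>A: "bij_betw \<rho>A A {1..card A}"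
  obtains \<rho> where "bij_betw \<rho> (U - {i} \<union> A) {1..card U + card A - 1}"
    and "\<And>u t. \<lbrakk>set_gen_tree u = U; set_gen_tree t = A\<rbrakk> \<Longrightarrow>
      map_gen_tree \<rho> (subst_tree (Leaf(i := t)) u)
      = graft (card A) (\<rho>U i) (map_gen_tree \<rho>U u) (map_gen_tree \<rho>A t)"
proof
  let ?m = "card U" and ?n = "card A" and ?i = "\<rho>U i"
  define \<rho> where "\<rho> x = (if x \<in> A then inner_pos ?i (\<rho>A x) else outer_pos ?n ?i (\<rho>U x))" for x
  have i': "?i \<in> {1..?m}"
    using i \<rho>U by (auto simp: bij_betw_def)
  have imA: "\<rho>A ` A = {1..?n}" and imU: "\<rho>U ` (U - {i}) = {1..?m} - {?i}"
    using \<rho>A \<rho>U i inj_on_image_set_diff[of \<rho>U U U "{i}"] by (auto simp: bij_betw_def)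
  have "\<rho> ` A = inner_pos ?i ` {1..?n}"
    unfolding imA[symmetric] by (auto simp: \<rho>_def image_image)
  moreover have "\<rho> ` (U - {i}) = outer_pos ?n ?i ` ({1..?m} - {?i})"
    unfolding imU[symmetric] using disj by (auto simp: \<rho>_def image_image)
  ultimately have im: "\<rho> ` (U - {i} \<union> A) = {1..?m + ?n - 1}"
    using inner_outer_image[OF i', of ?n] by (simp only: image_Un Un_commute)
  have "card (U - {i} \<union> A) = ?m + ?n - 1"
    using fin i disj card_gt_0_iff[of U] by (subst card_Un_disjoint) auto
  then show "bij_betw \<rho> (U - {i} \<union> A) {1..card U + card A - 1}"
    using im fin by (simp add: bij_betw_def eq_card_imp_inj_on)
  fix u t assume u: "set_gen_tree u = U" and t: "set_gen_tree t = A"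
  show "map_gen_tree \<rho> (subst_tree (Leaf(i := t)) u)
      = graft ?n ?i (map_gen_tree \<rho>U u) (map_gen_tree \<rho>A t)"
    unfolding graft_def map_subst subst_map
  proof (rule subst_cong)
    fix j assume "j \<in> set_gen_tree u"
    then have j: "j \<in> U" by (simp add: u)
    have "map_gen_tree \<rho> t = map_gen_tree (inner_pos ?i) (map_gen_tree \<rho>A t)"
      using t by (auto simp: gen_tree.map_comp \<rho>_def intro!: gen_tree.map_cong0)
    moreover have "\<rho>U j = ?i \<longleftrightarrow> j = i"
      using \<rho>U i j by (auto simp: bij_betw_def inj_on_def)
    moreover have "j \<noteq> i \<Longrightarrow> j \<notin> A"
      using j disj by blast
    ultimately show "map_gen_tree \<rho> ((Leaf(i := t)) j)
        = (if \<rho>U j = ?i then map_gen_tree (inner_pos ?i) (map_gen_tree \<rho>A t)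
           else Leaf (outer_pos ?n ?i (\<rho>U j)))"
      by (simp add: \<rho>_def)
  qed
qed

lemma ex_label_bij: "\<exists>\<rho>. bij_betw \<rho> (set_gen_tree t) {1..card (set_gen_tree t)}"
  using ex_bij_betw_nat_finite_1[of "set_gen_tree t"] by (meson bij_betw_inv finite_set_gen_tree)

lemma relabelled_in_trees:
  "\<lbrakk>linear_tree t; bij_betw \<rho> (set_gen_tree t) {1..n}\<rbrakk> \<Longrightarrow> map_gen_tree \<rho> t \<in> trees n"
  by (auto simp: trees_def gen_tree.set_map bij_betw_def intro: linear_map)

text \<open>The ideal is stable under composition in both arguments; the difference of the two composites is
  split as \<open>(u - u') \<circ> t + u' \<circ> (t - t')\<close>.\<close>

lemma tree_cong_subst:
  assumes u: "u \<approx> u'" and t: "t \<approx> t'" and i: "i \<in> set_gen_tree u"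
    and disj: "set_gen_tree t \<inter> (set_gen_tree u - {i}) = {}"
  shows "subst_tree (Leaf(i := t)) u \<approx> subst_tree (Leaf(i := t')) u'"
proof -
  let ?U = "set_gen_tree u" and ?A = "set_gen_tree t"
  let ?m = "card ?U" and ?n = "card ?A"
  let ?e = "\<lambda>t. Poly_Mapping.single t (1 :: real)"
  note u' = tree_congD[OF u] and t' = tree_congD[OF t]
  obtain \<rho>U \<rho>A where \<rho>U: "bij_betw \<rho>U ?U {1..?m}" and \<rho>A: "bij_betw \<rho>A ?A {1..?n}"
    using ex_label_bij by metis
  obtain \<rho> where \<rho>: "bij_betw \<rho> (?U - {i} \<union> ?A) {1..?m + ?n - 1}"
    and graft: "\<And>u t. \<lbrakk>set_gen_tree u = ?U; set_gen_tree t = ?A\<rbrakk> \<Longrightarrow>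
      map_gen_tree \<rho> (subst_tree (Leaf(i := t)) u)
      = graft ?n (\<rho>U i) (map_gen_tree \<rho>U u) (map_gen_tree \<rho>A t)"
    using subst_leaf_as_graft[OF i disj _ _ \<rho>U \<rho>A] by (metis finite_set_gen_tree)
  have i': "\<rho>U i \<in> {1..?m}"
    using i \<rho>U by (auto simp: bij_betw_def)
  have card: "card (?U - {i} \<union> ?A) = ?m + ?n - 1"
    using bij_betw_same_card[OF \<rho>] by simp
  have ideal: "?e (map_gen_tree \<rho>U u) - ?e (map_gen_tree \<rho>U u') \<in> com_triass_ideal ?m"
    "?e (map_gen_tree \<rho>A t) - ?e (map_gen_tree \<rho>A t') \<in> com_triass_ideal ?n"
    using tree_cong_ideal[OF u \<rho>U] tree_cong_ideal[OF t \<rho>A] by simp_all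
  have "map_gen_tree \<rho>U u' \<in> trees ?m" "map_gen_tree \<rho>A t \<in> trees ?n"
    using u' t' \<rho>U \<rho>A by (auto intro!: relabelled_in_trees simp del: One_nat_def)
  then have elts: "?e (map_gen_tree \<rho>U u') \<in> elts free_operad ?m"
    "?e (map_gen_tree \<rho>A t) \<in> elts free_operad ?n"
    by (auto intro!: single_elts simp del: free_simps)
  have "pcomp free_operad ?m ?n (\<rho>U i) (?e (map_gen_tree \<rho>U u) - ?e (map_gen_tree \<rho>U u'))
        (?e (map_gen_tree \<rho>A t))
      + pcomp free_operad ?m ?n (\<rho>U i) (?e (map_gen_tree \<rho>U u'))
        (?e (map_gen_tree \<rho>A t) - ?e (map_gen_tree \<rho>A t')) \<in> com_triass_ideal (?m + ?n - 1)"
    using ideal elts i' by (intro com_triass_ideal_closed)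
  then have "?e (map_gen_tree \<rho> (subst_tree (Leaf(i := t)) u))
      - ?e (map_gen_tree \<rho> (subst_tree (Leaf(i := t')) u'))
      \<in> com_triass_ideal (card (?U - {i} \<union> ?A))"
    using u' t' unfolding card
    by (simp add: graft pcomp_free_diff_left pcomp_free_diff_right pcomp_free_single
        del: One_nat_def)
  then show ?thesis
    using u' t' i disj \<rho> unfolding card[symmetric]
    by (intro tree_congI[where A = "?U - {i} \<union> ?A" and \<rho> = \<rho>] linear_subst_leaf set_subst_leaf[THEN trans])
      auto
qed

section \<open>Congruence is determined by the leading leaves\<close>
text \<open>The relations hold with arbitrary subtrees at the three leaves. The leaves are first renamed to labels
  above all labels of \<open>a\<close>, \<open>b\<close> and \<open>c\<close>, so that the three substitutions do not interfere.\<close>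

lemma defining_relation_instance:
  assumes rel: "(r, r') \<in> defining_relations"
    and lin: "linear_tree a" "linear_tree b" "linear_tree c"
    and disj: "set_gen_tree a \<inter> set_gen_tree b = {}" "set_gen_tree a \<inter> set_gen_tree c = {}"
      "set_gen_tree b \<inter> set_gen_tree c = {}"
  defines "h \<equiv> \<lambda>j. if j = 1 then a else if j = 2 then b else c"
  shows "subst_tree h r \<approx> subst_tree h r'"
proof -
  \<comment> \<open>All labels of \<open>a\<close>, \<open>b\<close>, \<open>c\<close> are below \<open>M\<close>, so \<open>M + 1\<close>, \<open>M + 2\<close>, \<open>M + 3\<close> are fresh.\<close>
  define M where "M = Suc (Max (set_gen_tree a \<union> set_gen_tree b \<union> set_gen_tree c))"
  have M: "j < M" if "j \<in> set_gen_tree a \<union> set_gen_tree b \<union> set_gen_tree c" for j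
    unfolding M_def by (rule le_imp_less_Suc, rule Max_ge) (use that in auto)
  have r: "linear_tree r" "set_gen_tree r = {1..3}" "linear_tree r'" "set_gen_tree r' = {1..3}"
    using defining_relations_props[OF rel] by (auto simp: trees_def)
  have "r \<approx> r'"
  proof (rule tree_congI[OF r])
    show "bij_betw id {1..3} {1..card {1..3::nat}}" by simp
    show "Poly_Mapping.single (map_gen_tree id r) 1 - Poly_Mapping.single (map_gen_tree id r') 1
        \<in> com_triass_ideal (card {1..3::nat})"
      using defining_relations_ideal[OF rel] by (simp add: gen_tree.map_id)
  qed
  moreover have "inj_on ((+) M) (set_gen_tree r)" by simp
  ultimately have 0: "map_gen_tree ((+) M) r \<approx> map_gen_tree ((+) M) r'"
    by (rule tree_cong_map)
  have set0: "set_gen_tree (map_gen_tree ((+) M) r) = {M + 1, M + 2, M + 3}"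
    using r(2) by (auto simp: gen_tree.set_map numeral_eq_Suc atLeastAtMostSuc_conv)
  have fresh: "M + k \<notin> set_gen_tree a" "M + k \<notin> set_gen_tree b" "M + k \<notin> set_gen_tree c" for k
    using M[of "M + k"] by auto
  have 1: "subst_tree (Leaf(M + 1 := a)) (map_gen_tree ((+) M) r)
      \<approx> subst_tree (Leaf(M + 1 := a)) (map_gen_tree ((+) M) r')" (is "?t1 \<approx> ?t1'")
    by (rule tree_cong_subst[OF 0 tree_cong_refl[OF lin(1)]]) (use fresh[of 1] fresh[of 2] fresh[of 3] set0 in auto)
  have set1: "set_gen_tree ?t1 = set_gen_tree a \<union> {M + 2, M + 3}"
    using set0 by (subst set_subst_leaf) auto
  have 2: "subst_tree (Leaf(M + 2 := b)) ?t1 \<approx> subst_tree (Leaf(M + 2 := b)) ?t1'"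
    (is "?t2 \<approx> ?t2'")
    by (rule tree_cong_subst[OF 1 tree_cong_refl[OF lin(2)]], unfold set1) (use fresh[of 2] fresh[of 3] disj in auto)
  have set2: "set_gen_tree ?t2 = set_gen_tree a \<union> set_gen_tree b \<union> {M + 3}"
    using set1 fresh[of 2] by (subst set_subst_leaf) auto
  have 3: "subst_tree (Leaf(M + 3 := c)) ?t2 \<approx> subst_tree (Leaf(M + 3 := c)) ?t2'"
    by (rule tree_cong_subst[OF 2 tree_cong_refl[OF lin(3)]], unfold set2) (use fresh[of 3] disj in auto)
  have ids: "subst_tree (Leaf(M + 2 := b)) a = a" "subst_tree (Leaf(M + 3 := c)) a = a"
    "subst_tree (Leaf(M + 3 := c)) b = b"
    using fresh[of 2] fresh[of 3] by (auto intro!: subst_id)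
  have final: "subst_tree (Leaf(M + 3 := c)) (subst_tree (Leaf(M + 2 := b))
      (subst_tree (Leaf(M + 1 := a)) (map_gen_tree ((+) M) q))) = subst_tree h q"
    if "set_gen_tree q = {1..3}" for q
  proof -
    have "subst_tree (Leaf(M + 3 := c)) (subst_tree (Leaf(M + 2 := b)) ((Leaf(M + 1 := a)) (M + j)))
        = h j" if "j \<in> set_gen_tree q" for j
    proof -
      from \<open>j \<in> set_gen_tree q\<close> have "1 \<le> j" "j \<le> 3"
        using \<open>set_gen_tree q = {1..3}\<close> by auto
      then consider "j = 1" | "j = 2" | "j = 3" by linarith
      then show ?thesis
        using ids by cases (auto simp: h_def)
    qed
    then have "subst_tree (\<lambda>j. subst_tree (Leaf(M + 3 := c)) (subst_tree (Leaf(M + 2 := b))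
        ((Leaf(M + 1 := a)) (M + j)))) q = subst_tree h q"
      by (rule subst_cong)
    then show ?thesis by (simp only: subst_map subst_subst)
  qed
  show ?thesis
    using 3 r unfolding final[OF r(2)] final[OF r(4)] by simp
qed

text \<open>Substitution into a single vertex with two fresh leaves shows that congruence is compatible with
  the tree constructors.\<close>

lemma tree_cong_vertex:
  assumes s: "s \<approx> s'" and t: "t \<approx> t'" and disj: "set_gen_tree s \<inter> set_gen_tree t = {}"
  shows "Nu s t \<approx> Nu s' t'" "Mu (Upair s t) \<approx> Mu (Upair s' t')"
proof -
  define M where "M = Suc (Max (set_gen_tree s \<union> set_gen_tree t))"
  have M: "j < M" if "j \<in> set_gen_tree s \<union> set_gen_tree t" for j
    unfolding M_def by (rule le_imp_less_Suc, rule Max_ge) (use that in auto)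
  have fresh: "M + k \<notin> set_gen_tree s" "M + k \<notin> set_gen_tree t"
    "M + k \<notin> set_gen_tree s'" for k
    using M[of "M + k"] tree_congD[OF s] by auto
  have step: "subst_tree (Leaf(M + 1 := t)) (subst_tree (Leaf(M := s)) u)
      \<approx> subst_tree (Leaf(M + 1 := t')) (subst_tree (Leaf(M := s')) u)"
    if "linear_tree u" "set_gen_tree u = {M, M + 1}" for u
  proof -
    have "subst_tree (Leaf(M := s)) u \<approx> subst_tree (Leaf(M := s')) u"
      by (rule tree_cong_subst[OF tree_cong_refl[OF that(1)] s]) (use that fresh[of 1] in auto)
    moreover have "set_gen_tree (subst_tree (Leaf(M := s)) u) = set_gen_tree s \<union> {M + 1}"
      using that by (subst set_subst_leaf) auto
    ultimately show ?thesis
      by (rule_tac tree_cong_subst[OF _ t]) (use fresh[of 1] disj in auto)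
  qed
  have id: "subst_tree (Leaf(M + 1 := t)) s = s" "subst_tree (Leaf(M + 1 := t')) s' = s'"
    using fresh[of 1] by (auto intro!: subst_id)
  show "Nu s t \<approx> Nu s' t'"
    using step[of "Nu (Leaf M) (Leaf (M + 1))"] by (simp add: id insert_commute del: One_nat_def)
  show "Mu (Upair s t) \<approx> Mu (Upair s' t')"
    using step[of "Mu (Upair (Leaf M) (Leaf (M + 1)))"] by (simp add: id insert_commute del: One_nat_def)
qed

lemma tree_cong_relations:
  assumes "linear_tree a" "linear_tree b" "linear_tree c"
    and "set_gen_tree a \<inter> set_gen_tree b = {}" "set_gen_tree a \<inter> set_gen_tree c = {}"
      "set_gen_tree b \<inter> set_gen_tree c = {}"
  shows "Mu (Upair (Mu (Upair a b)) c) \<approx> Mu (Upair a (Mu (Upair b c)))"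
    "Nu (Nu a b) c \<approx> Nu a (Nu b c)"
    "Nu a (Nu b c) \<approx> Nu a (Nu c b)"
    "Nu a (Mu (Upair b c)) \<approx> Nu a (Nu b c)"
    "Nu (Mu (Upair a b)) c \<approx> Mu (Upair a (Nu b c))"
  using defining_relation_instance[OF _ assms, unfolded defining_relations_def Let_def]
  by force+

text \<open>The leaf \<open>d\<close> can be moved to the second branch of a \<open>Nu\<close> vertex at the root, which keeps the leading
  leaves.\<close>

definition splits_off :: "nat gen_tree \<Rightarrow> nat \<Rightarrow> bool" where
  "splits_off t d \<longleftrightarrow> (\<exists>s. linear_tree s \<and> set_gen_tree s = set_gen_tree t - {d} \<and>
     leading s = leading t \<and> t \<approx> Nu s (Leaf d))"

lemma splits_off_cong:
  assumes "t \<approx> t'" "leading t = leading t'" "splits_off t' d"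
  shows "splits_off t d"
  using assms tree_congD(3)[OF assms(1)] unfolding splits_off_def by (metis tree_cong_trans)

text \<open>Below the second branch of a \<open>Nu\<close> vertex the relations do not distinguish the kinds of vertices nor
  the order of branches. So the branch that contains \<open>d\<close> may be put last, and the other one is absorbed
  into the first argument by \<open>\<nu>(a, \<nu>(p, q)) \<approx> \<nu>(\<nu>(a, p), q)\<close>.\<close>

lemma splits_off_Nu_right:
  assumes "linear_tree (Nu a b)" "d \<in> set_gen_tree b"
  shows "splits_off (Nu a b) d"
  using assms
proof (induction b arbitrary: a rule: gen_tree_pair_induct)
  case (Leaf x)
  then show ?case
    unfolding splits_off_def by (intro exI[of _ a]) (auto intro: tree_cong_refl)
next
  case (Nu p q)
  show ?case
  proof (cases "d \<in> set_gen_tree q")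
    case True
    have "Nu a (Nu p q) \<approx> Nu (Nu a p) q"
      using Nu.prems by (intro tree_cong_sym[OF tree_cong_relations(2)]) auto
    moreover have "splits_off (Nu (Nu a p) q) d"
      using Nu.prems True by (intro Nu.IH) auto
    ultimately show ?thesis
      by (auto intro: splits_off_cong)
  next
    case False
    have "Nu a (Nu p q) \<approx> Nu a (Nu q p)"
      using Nu.prems by (intro tree_cong_relations(3)) auto
    also have "\<dots> \<approx> Nu (Nu a q) p"
      using Nu.prems by (intro tree_cong_sym[OF tree_cong_relations(2)]) auto
    finally have "Nu a (Nu p q) \<approx> Nu (Nu a q) p" .
    moreover have "splits_off (Nu (Nu a q) p) d"
      using Nu.prems False by (intro Nu.IH) auto
    ultimately show ?thesis
      by (auto intro: splits_off_cong)
  qed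
next
  case (Mu p q)
  have Nu: "Nu a (Mu (Upair p q)) \<approx> Nu a (Nu p q)"
    using Mu.prems by (intro tree_cong_relations(4)) auto
  show ?case
  proof (cases "d \<in> set_gen_tree q")
    case True
    note Nu
    also have "Nu a (Nu p q) \<approx> Nu (Nu a p) q"
      using Mu.prems by (intro tree_cong_sym[OF tree_cong_relations(2)]) auto
    finally have "Nu a (Mu (Upair p q)) \<approx> Nu (Nu a p) q" .
    moreover have "splits_off (Nu (Nu a p) q) d"
      using Mu.prems True by (intro Mu.IH) auto
    ultimately show ?thesis
      by (auto intro: splits_off_cong)
  next
    case False
    note Nu
    also have "Nu a (Nu p q) \<approx> Nu a (Nu q p)"
      using Mu.prems by (intro tree_cong_relations(3)) auto
    also have "\<dots> \<approx> Nu (Nu a q) p"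
      using Mu.prems by (intro tree_cong_sym[OF tree_cong_relations(2)]) auto
    finally have "Nu a (Mu (Upair p q)) \<approx> Nu (Nu a q) p" .
    moreover have "splits_off (Nu (Nu a q) p) d"
      using Mu.prems False by (intro Mu.IH) auto
    ultimately show ?thesis
      by (auto intro: splits_off_cong)
  qed
qed

text \<open>The relation \<open>\<nu> \<circ>\<^sub>1 \<mu> = \<mu> \<circ>\<^sub>2 \<nu>\<close> moves a leaf that is split off from a branch to the root.\<close>

lemma splits_off_Mu_right:
  assumes "linear_tree (Mu (Upair a b))" "splits_off b d" "d \<in> set_gen_tree b"
  shows "splits_off (Mu (Upair a b)) d"
proof -
  obtain s where s: "linear_tree s" "set_gen_tree s = set_gen_tree b - {d}"
    "leading s = leading b" "b \<approx> Nu s (Leaf d)"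
    using assms(2) unfolding splits_off_def by blast
  have "Mu (Upair a b) \<approx> Mu (Upair a (Nu s (Leaf d)))"
    using assms s by (intro tree_cong_vertex(2) tree_cong_refl) auto
  also have "\<dots> \<approx> Nu (Mu (Upair a s)) (Leaf d)"
    using assms s by (intro tree_cong_sym[OF tree_cong_relations(5)]) auto
  finally show ?thesis
    using assms s unfolding splits_off_def by (intro exI[of _ "Mu (Upair a s)"]) auto
qed

lemma splits_off_nonleading:
  assumes "linear_tree t" "d \<in> set_gen_tree t - leading t"
  shows "splits_off t d"
  using assms
proof (induction t rule: gen_tree_pair_induct)
  case (Nu a b)
  show ?case
  proof (cases "d \<in> set_gen_tree b")
    case True
    then show ?thesis using Nu.prems splits_off_Nu_right by blast
  next
    case False
    then obtain s where s: "linear_tree s" "set_gen_tree s = set_gen_tree a - {d}"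
      "leading s = leading a" "a \<approx> Nu s (Leaf d)"
      using Nu unfolding splits_off_def by auto
    have "Nu a b \<approx> Nu (Nu s (Leaf d)) b"
      using Nu.prems s by (intro tree_cong_vertex(1) tree_cong_refl) auto
    also have "\<dots> \<approx> Nu s (Nu (Leaf d) b)"
      using Nu.prems s False by (intro tree_cong_relations(2)) auto
    finally have "Nu a b \<approx> Nu s (Nu (Leaf d) b)" .
    moreover have "splits_off (Nu s (Nu (Leaf d) b)) d"
      using tree_congD(2)[OF calculation] by (intro splits_off_Nu_right) auto
    ultimately show ?thesis
      using s by (auto intro: splits_off_cong)
  qed
next
  case (Mu a b)
  show ?case
  proof (cases "d \<in> set_gen_tree b")
    case True
    then show ?thesis using Mu by (intro splits_off_Mu_right) auto
  next
    case False
    then have "splits_off (Mu (Upair b a)) d"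
      using Mu by (intro splits_off_Mu_right) auto
    moreover have "Upair b a = Upair a b" by simp
    ultimately show ?thesis by (simp only:)
  qed
qed simp

text \<open>If all leaves are leading, then every vertex is a \<open>Mu\<close> and the claim is associativity and
  commutativity of \<open>\<mu>\<close>.\<close>

lemma extract_leading_leaf:
  assumes "linear_tree t" "leading t = set_gen_tree t" "x \<in> set_gen_tree t" "t \<noteq> Leaf x"
  shows "\<exists>s. linear_tree s \<and> set_gen_tree s = set_gen_tree t - {x} \<and>
    leading s = set_gen_tree s \<and> t \<approx> Mu (Upair s (Leaf x))"
  using assms
proof (induction t rule: gen_tree_pair_induct)
  case (Nu a b)
  then have "set_gen_tree b \<subseteq> set_gen_tree a"
    using leading_subset[of a] by auto
  moreover have "set_gen_tree a \<inter> set_gen_tree b = {}" using Nu.prems(1) by simp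
  ultimately have "set_gen_tree b = {}" by blast
  then show ?case by simp
next
  case (Mu a b)
  have lead: "leading a = set_gen_tree a" "leading b = set_gen_tree b"
    using Mu.prems leading_subset[of a] leading_subset[of b] by auto
  have main: "\<exists>s. linear_tree s \<and> set_gen_tree s = set_gen_tree a \<union> set_gen_tree b - {x} \<and>
      leading s = set_gen_tree s \<and> Mu (Upair a b) \<approx> Mu (Upair s (Leaf x))"
    if IH: "b \<noteq> Leaf x \<Longrightarrow> \<exists>s. linear_tree s \<and> set_gen_tree s = set_gen_tree b - {x} \<and>
          leading s = set_gen_tree s \<and> b \<approx> Mu (Upair s (Leaf x))"
      and ab: "linear_tree (Mu (Upair a b))" "leading a = set_gen_tree a" "x \<in> set_gen_tree b"
    for a b
  proof (cases "b = Leaf x")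
    case True
    with ab have "linear_tree a \<and> set_gen_tree a = set_gen_tree a \<union> set_gen_tree b - {x} \<and>
        leading a = set_gen_tree a \<and> Mu (Upair a b) \<approx> Mu (Upair a (Leaf x))"
      by (auto intro: tree_cong_refl)
    then show ?thesis by blast
  next
    case False
    then obtain s where s: "linear_tree s" "set_gen_tree s = set_gen_tree b - {x}"
      "leading s = set_gen_tree s" "b \<approx> Mu (Upair s (Leaf x))"
      using IH by blast
    have "Mu (Upair a b) \<approx> Mu (Upair a (Mu (Upair s (Leaf x))))"
      using ab s by (intro tree_cong_vertex(2) tree_cong_refl) auto
    also have "\<dots> \<approx> Mu (Upair (Mu (Upair a s)) (Leaf x))"
      using ab s by (intro tree_cong_sym[OF tree_cong_relations(1)]) auto
    finally show ?thesis
      using ab s by (intro exI[of _ "Mu (Upair a s)"]) auto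
  qed
  show ?case
  proof (cases "x \<in> set_gen_tree b")
    case True
    then show ?thesis
      using main[OF Mu.IH(2)] Mu.prems(1) lead by simp
  next
    case False
    then have "x \<in> set_gen_tree a" using Mu.prems(3) by simp
    moreover have "linear_tree (Mu (Upair b a))" using Mu.prems(1) by auto
    moreover have "Upair b a = Upair a b" by simp
    ultimately show ?thesis
      using main[OF Mu.IH(1), of b] Mu.prems(1) lead unfolding gen_tree.set
      by (simp only: Un_commute set_uprod_simps) (simp add: Un_commute)
  qed
qed simp

lemma linear_tree_singleton:
  assumes "linear_tree t" "set_gen_tree t = {x}"
  shows "t = Leaf x"
proof (cases t)
  case (Leaf a)
  then show ?thesis using assms(2) by simp
next
  case (Nu p q)
  obtain y z where "y \<in> set_gen_tree p" "z \<in> set_gen_tree q"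
    using set_gen_tree_nonempty[of p] set_gen_tree_nonempty[of q] by blast
  moreover from this have "y = x" "z = x" using assms(2) Nu by auto
  ultimately show ?thesis using assms(1) Nu by auto
next
  case (Mu u)
  then obtain p q where t: "t = Mu (Upair p q)" by (cases u) blast
  obtain y z where "y \<in> set_gen_tree p" "z \<in> set_gen_tree q"
    using set_gen_tree_nonempty[of p] set_gen_tree_nonempty[of q] by blast
  moreover from this have "y = x" "z = x" using assms(2) t by auto
  ultimately show ?thesis using assms(1) t by auto
qed

text \<open>Take a leaf that is not leading if there is one, and an arbitrary leaf otherwise. Both trees can be
  rewritten with this leaf at the root, and the remaining subtrees satisfy the hypotheses again.\<close>

lemma tree_cong_of_leading:
  assumes "linear_tree s" "linear_tree t" "set_gen_tree s = set_gen_tree t" "leading s = leading t"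
  shows "s \<approx> t"
  using assms
proof (induction "card (set_gen_tree s)" arbitrary: s t rule: less_induct)
  case less
  have smaller: "card (set_gen_tree s - {x}) < card (set_gen_tree s)" if "x \<in> set_gen_tree s" for x
    using that by (intro psubset_card_mono) auto
  show ?case
  proof (cases "leading s = set_gen_tree s")
    case False
    then obtain d where d: "d \<in> set_gen_tree s - leading s"
      using leading_subset[of s] by blast
    obtain s' t' where s': "linear_tree s'" "set_gen_tree s' = set_gen_tree s - {d}"
        "leading s' = leading s" "s \<approx> Nu s' (Leaf d)"
      and t': "linear_tree t'" "set_gen_tree t' = set_gen_tree t - {d}"
        "leading t' = leading t" "t \<approx> Nu t' (Leaf d)"
      using splits_off_nonleading[of s d] splits_off_nonleading[of t d] d less.prems
      unfolding splits_off_def by auto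
    have "s' \<approx> t'"
      using less.hyps[of s' t'] smaller d s' t' less.prems by auto
    then have "Nu s' (Leaf d) \<approx> Nu t' (Leaf d)"
      using s' by (intro tree_cong_vertex(1) tree_cong_refl) auto
    then show ?thesis
      using s'(4) tree_cong_sym[OF t'(4)] by (blast intro: tree_cong_trans)
  next
    case True
    obtain x where x: "x \<in> set_gen_tree s"
      using set_gen_tree_nonempty[of s] by blast
    show ?thesis
    proof (cases "s = Leaf x \<or> t = Leaf x")
      case leaf: True
      have "s = t"
        using leaf linear_tree_singleton[of s x] linear_tree_singleton[of t x] less.prems by auto
      then show ?thesis using less.prems by (simp add: tree_cong_refl)
    next
      case False
      obtain s' t' where s': "linear_tree s'" "set_gen_tree s' = set_gen_tree s - {x}"
          "leading s' = set_gen_tree s'" "s \<approx> Mu (Upair s' (Leaf x))"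
        and t': "linear_tree t'" "set_gen_tree t' = set_gen_tree t - {x}"
          "leading t' = set_gen_tree t'" "t \<approx> Mu (Upair t' (Leaf x))"
        using extract_leading_leaf[of s x] extract_leading_leaf[of t x] x True False less.prems
        by auto
      have "s' \<approx> t'"
        using less.hyps[of s' t'] smaller x s' t' less.prems by auto
      then have "Mu (Upair s' (Leaf x)) \<approx> Mu (Upair t' (Leaf x))"
        using s' by (intro tree_cong_vertex(2) tree_cong_refl) auto
      then show ?thesis
        using s'(4) tree_cong_sym[OF t'(4)] by (blast intro: tree_cong_trans)
    qed
  qed
qed

section \<open>Unanimity games and the kernel of the evaluation\<close>
abbreviation coalitions :: "nat \<Rightarrow> nat set set" where
  "coalitions n \<equiv> {S. S \<subseteq> {1..n} \<and> S \<noteq> {}}"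

lemma finite_coalitions [simp]: "finite (coalitions n)"
  by simp

text \<open>Evaluation at \<open>S\<close> involves only the coefficients of subsets of \<open>S\<close>, so the system is triangular.\<close>

lemma unanimity_independent:
  assumes zero: "\<And>R. R \<subseteq> {1..n} \<Longrightarrow> (\<Sum>S\<in>coalitions n. c S * unanimity n S R) = 0"
    and S: "S \<in> coalitions n"
  shows "c S = 0"
proof -
  have "finite S" using S finite_subset by auto
  then show ?thesis
    using S
  proof (induction S rule: finite_psubset_induct)
    case (psubset S)
    have "(\<Sum>S'\<in>coalitions n. c S' * unanimity n S' S) = (\<Sum>S'\<in>{S}. c S' * unanimity n S' S)"
    proof (rule sum.mono_neutral_right)
      show "\<forall>S'\<in>coalitions n - {S}. c S' * unanimity n S' S = 0"
      proof
        fix S' assume S': "S' \<in> coalitions n - {S}"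
        show "c S' * unanimity n S' S = 0"
        proof (cases "S' \<subseteq> S")
          case True
          then have "c S' = 0" using S' by (intro psubset.IH) auto
          then show ?thesis by simp
        qed (simp add: unanimity_def)
      qed
    qed (use psubset.prems in auto)
    then show ?case
      using zero[of S] psubset.prems by (simp add: unanimity_def)
  qed
qed

lemma sum_moebius:
  assumes "finite R"
  shows "(\<Sum>S\<in>Pow R. moebius v S) = v R"
proof -
  \<comment> \<open>the signed sum for which inversion is symmetric; \<open>moebius v S = (-1) ^ card S * g S\<close>\<close>
  define g where "g S = (\<Sum>T\<in>Pow S. (-1) ^ card T * v T)" for S
  have "v R = (\<Sum>S\<in>Pow R. (-1) ^ card S * g S)"
    by (rule inclusion_exclusion_symmetric[where f = v and g = g, OF _ assms]) (rule g_def)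
  also have "\<dots> = (\<Sum>S\<in>Pow R. moebius v S)"
  proof (rule sum.cong[OF refl])
    fix S assume "S \<in> Pow R"
    then have S: "finite S" using assms finite_subset by auto
    have "(-1) ^ card S * ((-1) ^ card T * v T) = (-1) ^ card (S - T) * v T" if "T \<subseteq> S" for T
    proof -
      have T: "finite T" using S that finite_subset by auto
      have "card S = card (S - T) + card T"
        using S T that by (simp add: card_Diff_subset card_mono)
      then have "(-1) ^ card S = (-1) ^ card (S - T) * (-1 :: real) ^ card T"
        by (simp only: power_add)
      moreover have "(-1 :: real) ^ card T * (-1) ^ card T = 1"
        by (simp only: power_mult_distrib[symmetric]) simp
      ultimately show ?thesis
        by (simp only: mult.assoc[symmetric]) (simp only: mult.assoc mult_1_right)
    qed
    then show "(-1) ^ card S * g S = moebius v S"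
      unfolding g_def moebius_def sum_distrib_left by (intro sum.cong refl) blast
  qed
  finally show ?thesis ..
qed

lemma game_moebius_expansion:
  assumes v: "v \<in> elts games n"
  shows "v = (\<lambda>R. \<Sum>S\<in>coalitions n. moebius v S * unanimity n S R)"
proof
  fix R
  show "v R = (\<Sum>S\<in>coalitions n. moebius v S * unanimity n S R)"
  proof (cases "R \<subseteq> {1..n}")
    case True
    have "moebius v {} = 0" using v by (simp add: moebius_def)
    have "v R = (\<Sum>S\<in>Pow R. moebius v S)"
      using True finite_subset by (intro sum_moebius[symmetric]) blast
    also have "\<dots> = (\<Sum>S\<in>Pow R - {{}}. moebius v S)"
      using True finite_subset \<open>moebius v {} = 0\<close>
      by (intro sum.mono_neutral_right) auto
    also have "\<dots> = (\<Sum>S\<in>Pow R - {{}}. moebius v S * unanimity n S R)"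
      using True by (intro sum.cong) (auto simp: unanimity_def)
    also have "\<dots> = (\<Sum>S\<in>coalitions n. moebius v S * unanimity n S R)"
      using True by (intro sum.mono_neutral_left) (auto simp: unanimity_def)
    finally show ?thesis .
  next
    case False
    then show ?thesis using v by (simp add: unanimity_def)
  qed
qed

lemma ex_linear_tree:
  assumes "finite S" "S \<noteq> {}" "finite D" "S \<inter> D = {}"
  shows "\<exists>t. linear_tree t \<and> set_gen_tree t = S \<union> D \<and> leading t = S"
  using assms(3,4)
proof (induction D)
  case empty
  show ?case
    using assms(1,2)
  proof (induction S rule: finite_ne_induct)
    case (singleton x)
    show ?case by (intro exI[of _ "Leaf x"]) simp
  next
    case (insert x S)
    then obtain t where "linear_tree t" "set_gen_tree t = S" "leading t = S" by auto
    then show ?case using insert.hyps by (intro exI[of _ "Mu (Upair t (Leaf x))"]) auto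
  qed
next
  case (insert x D)
  then obtain t where "linear_tree t" "set_gen_tree t = S \<union> D" "leading t = S" by auto
  then show ?case using insert by (intro exI[of _ "Nu t (Leaf x)"]) auto
qed

lemma ex_tree_leading:
  assumes "S \<in> coalitions n"
  shows "\<exists>t\<in>trees n. leading t = S"
  using ex_linear_tree[of S "{1..n} - S"] assms finite_subset[of S "{1..n}"]
  by (auto simp: trees_def Un_absorb1)

text \<open>The choice is immaterial: by \<open>tree_cong_of_leading\<close> all candidates are congruent.\<close>

definition tree_for :: "nat \<Rightarrow> nat set \<Rightarrow> nat gen_tree" where
  "tree_for n S = (SOME t. t \<in> trees n \<and> leading t = S)"

lemma tree_for:
  assumes "S \<in> coalitions n"
  shows "tree_for n S \<in> trees n" "leading (tree_for n S) = S"
  using someI_ex[of "\<lambda>t. t \<in> trees n \<and> leading t = S"] ex_tree_leading[OF assms]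
  by (auto simp: tree_for_def)

lemma trees_same_leading_ideal:
  assumes "s \<in> trees n" "t \<in> trees n" "leading s = leading t"
  shows "Poly_Mapping.single s 1 - Poly_Mapping.single t 1 \<in> com_triass_ideal n"
proof -
  have "s \<approx> t"
    using assms by (intro tree_cong_of_leading) (auto simp: trees_def)
  moreover have "bij_betw id (set_gen_tree s) {1..card (set_gen_tree s)}"
    using assms by (simp add: trees_def)
  ultimately show ?thesis
    using tree_cong_ideal[of s t id] assms by (simp add: gen_tree.map_id trees_def)
qed

text \<open>Modulo the ideal, each tree may be replaced by the chosen one with the same leading leaves. An element
  of the kernel then becomes a combination of the chosen trees whose coefficients are those of its
  evaluation in the independent unanimity games, hence zero.\<close>

lemma com_triass_ideal_eq_kernel: "com_triass_ideal n = eval_kernel n"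
proof (rule equalityI[OF com_triass_ideal_subset], rule subsetI)
  fix f assume "f \<in> eval_kernel n"
  then have f: "f \<in> elts free_operad n" and zero: "free_eval n f = (\<lambda>R. 0)"
    by (auto simp: eval_kernel_def)
  let ?K = "Poly_Mapping.keys f" and ?c = "Poly_Mapping.lookup f"
  have K: "leading t \<in> coalitions n" "t \<in> trees n" if "t \<in> ?K" for t
    using leading_trees[of t n] keys_elts[OF f] that by auto
  \<comment> \<open>the coefficient of the unanimity game of \<open>S\<close> in the evaluation of \<open>f\<close>\<close>
  define c where "c S = (\<Sum>t\<in>{t \<in> ?K. leading t = S}. ?c t)" for S
  have group: "(\<Sum>S\<in>coalitions n. \<Sum>t\<in>{t \<in> ?K. leading t = S}. h t) = sum h ?K"
    for h :: "nat gen_tree \<Rightarrow> 'c :: comm_monoid_add"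
    using K by (intro sum.group) auto
  have c: "c S = 0" if "S \<in> coalitions n" for S
  proof (rule unanimity_independent[OF _ that])
    fix R
    have "(\<Sum>S\<in>coalitions n. c S * unanimity n S R) = free_eval n f R"
      unfolding free_eval_def group[symmetric] c_def sum_distrib_right
      by (intro sum.cong refl) auto
    then show "(\<Sum>S\<in>coalitions n. c S * unanimity n S R) = 0"
      using zero by simp
  qed
  have "(\<Sum>t\<in>?K. Poly_Mapping.single (tree_for n (leading t)) (?c t))
      = (\<Sum>S\<in>coalitions n. Poly_Mapping.single (tree_for n S) (c S))"
    unfolding group[symmetric] c_def
  proof (intro sum.cong refl)
    fix S
    have "(\<Sum>t\<in>A. Poly_Mapping.single u (?c t)) = Poly_Mapping.single u (\<Sum>t\<in>A. ?c t)" for A and u :: "nat gen_tree"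
      by (induction A rule: infinite_finite_induct) (simp_all add: single_add)
    then show "(\<Sum>t\<in>{t \<in> ?K. leading t = S}. Poly_Mapping.single (tree_for n (leading t)) (?c t))
        = Poly_Mapping.single (tree_for n S) (\<Sum>t\<in>{t \<in> ?K. leading t = S}. ?c t)"
      by simp
  qed
  then have normal_form: "(\<Sum>t\<in>?K. Poly_Mapping.single (tree_for n (leading t)) (?c t)) = 0"
    using c by simp
  have sum_closed: "sum g A \<in> com_triass_ideal n" if "\<And>a. a \<in> A \<Longrightarrow> g a \<in> com_triass_ideal n"
    for g :: "nat gen_tree \<Rightarrow> _" and A
    using that
    by (induction A rule: infinite_finite_induct) (auto intro: com_triass_ideal_closed)
  have "(\<Sum>t\<in>?K. Poly_Mapping.map ((*) (?c t))
      (Poly_Mapping.single t 1 - Poly_Mapping.single (tree_for n (leading t)) 1)) \<in> com_triass_ideal n"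
    using K by (intro sum_closed com_triass_ideal_closed(3) trees_same_leading_ideal) (auto simp: tree_for)
  moreover have "Poly_Mapping.map ((*) r) (Poly_Mapping.single s 1 - Poly_Mapping.single t 1)
      = Poly_Mapping.single s r - Poly_Mapping.single t r" for r :: real and s t :: "nat gen_tree"
    by (rule poly_mapping_eqI) (simp add: lookup_minus lookup_single when_def)
  moreover have "(\<Sum>t\<in>?K. Poly_Mapping.single t (?c t)) = f"
    by (rule poly_mapping_eqI) (auto simp: lookup_sum lookup_single when_def in_keys_iff)
  ultimately show "f \<in> com_triass_ideal n"
    using normal_form by (simp add: sum_subtractf)
qed

section \<open>The isomorphism on the quotient\<close>

definition ct_class :: "nat \<Rightarrow> (nat gen_tree \<Rightarrow>\<^sub>0 real) \<Rightarrow> (nat gen_tree \<Rightarrow>\<^sub>0 real) set" where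
  "ct_class n f = com_triass_ideal n +>\<^bsub>component free_operad n\<^esub> f"

lemma ct_class_eq:
  assumes "f \<in> elts free_operad n"
  shows "ct_class n f = {g \<in> elts free_operad n. free_eval n g = free_eval n f}"
proof -
  have "g \<in> ct_class n f \<longleftrightarrow> g - f \<in> eval_kernel n" for g
  proof
    assume "g - f \<in> eval_kernel n"
    then have "g - f + f \<in> ct_class n f"
      unfolding ct_class_def a_r_coset_def' com_triass_ideal_eq_kernel by force
    then show "g \<in> ct_class n f" by simp
  qed (auto simp: ct_class_def a_r_coset_def' com_triass_ideal_eq_kernel)
  moreover have "g - f \<in> elts free_operad n \<longleftrightarrow> g \<in> elts free_operad n" for g
    using assms by (auto simp: lookup_minus)
  ultimately show ?thesis
    by (auto simp: eval_kernel_def fun_eq_iff simp del: free_simps)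
qed

lemma ct_class_refl: "f \<in> elts free_operad n \<Longrightarrow> f \<in> ct_class n f"
  by (simp add: ct_class_eq del: free_simps)

lemma elts_com_triass: "elts com_triass n = ct_class n ` elts free_operad n"
  by (auto simp: com_triass_def quot_operad_def quot_space_def A_RCOSETS_def' ct_class_def)

text \<open>By \<open>ct_class_eq\<close> all representatives of a class have the same evaluation.\<close>

definition ct_eval :: "nat \<Rightarrow> (nat gen_tree \<Rightarrow>\<^sub>0 real) set \<Rightarrow> game" where
  "ct_eval n X = free_eval n (SOME f. f \<in> X)"

lemma ct_eval_class [simp]: "f \<in> elts free_operad n \<Longrightarrow> ct_eval n (ct_class n f) = free_eval n f"
  using someI[of "\<lambda>g. g \<in> ct_class n f" f] ct_class_refl[of f n]
  by (simp add: ct_eval_def ct_class_eq del: free_simps)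

lemma ct_class_eqI:
  "\<lbrakk>f \<in> elts free_operad n; g \<in> elts free_operad n; free_eval n f = free_eval n g\<rbrakk> \<Longrightarrow>
    ct_class n f = ct_class n g"
  by (simp add: ct_class_eq del: free_simps)

lemma free_closed:
  "f \<in> elts free_operad n \<Longrightarrow> g \<in> elts free_operad n \<Longrightarrow> f + g \<in> elts free_operad n"
  "f \<in> elts free_operad n \<Longrightarrow> Poly_Mapping.map ((*) r) f \<in> elts free_operad n"
  "0 \<in> elts free_operad n"
  by (auto simp: lookup_add)

lemma ct_zero: "\<zero>\<^bsub>component com_triass n\<^esub> = ct_class n 0"
proof -
  have "\<zero>\<^bsub>component com_triass n\<^esub> = eval_kernel n"
    by (simp add: com_triass_def quot_operad_def quot_space_def com_triass_ideal_eq_kernel)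
  then show ?thesis
    by (simp add: ct_class_eq free_closed(3) eval_kernel_def del: free_simps)
qed

lemma ct_add:
  assumes f: "f \<in> elts free_operad n" and g: "g \<in> elts free_operad n"
  shows "ct_class n f \<oplus>\<^bsub>component com_triass n\<^esub> ct_class n g = ct_class n (f + g)"
proof -
  have "ct_class n f \<oplus>\<^bsub>component com_triass n\<^esub> ct_class n g
      = (\<Union>f'\<in>ct_class n f. \<Union>g'\<in>ct_class n g. {f' + g'})"
    by (simp add: com_triass_def quot_operad_def quot_space_def set_add_def')
  also have "\<dots> = ct_class n (f + g)"
  proof (intro equalityI subsetI)
    fix h assume h: "h \<in> ct_class n (f + g)"
    then have "h - g \<in> ct_class n f"
      using f g by (simp add: ct_class_eq free_closed del: free_simps)
        (auto simp: lookup_minus)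
    moreover have "h = (h - g) + g" by simp
    ultimately show "h \<in> (\<Union>f'\<in>ct_class n f. \<Union>g'\<in>ct_class n g. {f' + g'})"
      using ct_class_refl[OF g] by blast
  qed (use f g in \<open>auto simp: ct_class_eq free_closed simp del: free_simps\<close>)
  finally show ?thesis .
qed

text \<open>The operations of the quotient are unions over representatives; such a union collapses when the
  result depends only on the evaluation of the representative.\<close>

lemma UN_ct_class:
  assumes f: "f \<in> elts free_operad n"
    and F: "\<And>g. \<lbrakk>g \<in> elts free_operad n; free_eval n g = free_eval n f\<rbrakk> \<Longrightarrow> F g = Z"
  shows "(\<Union>g\<in>ct_class n f. F g) = Z"
  using ct_class_refl[OF f] F by (auto simp: ct_class_eq[OF f] simp del: free_simps)

lemma ct_smult:
  assumes f: "f \<in> elts free_operad n"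
  shows "r \<odot>\<^bsub>component com_triass n\<^esub> ct_class n f = ct_class n (Poly_Mapping.map ((*) r) f)"
proof -
  have "r \<odot>\<^bsub>component com_triass n\<^esub> ct_class n f
      = (\<Union>g\<in>ct_class n f. ct_class n (Poly_Mapping.map ((*) r) g))"
    by (simp add: com_triass_def quot_operad_def quot_space_def ct_class_def)
  also have "\<dots> = ct_class n (Poly_Mapping.map ((*) r) f)"
    using f by (intro UN_ct_class ct_class_eqI) (auto simp: free_closed simp del: free_simps)
  finally show ?thesis .
qed

lemma ct_act:
  assumes \<sigma>: "\<sigma> permutes {1..n}" and f: "f \<in> elts free_operad n"
  shows "act com_triass n \<sigma> (ct_class n f) = ct_class n (act free_operad n \<sigma> f)"
proof -
  have "act com_triass n \<sigma> (ct_class n f) = (\<Union>g\<in>ct_class n f. ct_class n (act free_operad n \<sigma> g))"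
    by (simp add: com_triass_def quot_operad_def ct_class_def)
  also have "\<dots> = ct_class n (act free_operad n \<sigma> f)"
    using f by (intro UN_ct_class ct_class_eqI)
      (auto simp: act_free_closed[OF \<sigma>] free_eval_act[OF \<sigma>] simp del: free_simps games_simps)
  finally show ?thesis .
qed

lemma ct_pcomp:
  assumes i: "i \<in> {1..m}" and f: "f \<in> elts free_operad m" and g: "g \<in> elts free_operad n"
  shows "pcomp com_triass m n i (ct_class m f) (ct_class n g)
    = ct_class (m + n - 1) (pcomp free_operad m n i f g)"
proof -
  have "pcomp com_triass m n i (ct_class m f) (ct_class n g)
      = (\<Union>f'\<in>ct_class m f. \<Union>g'\<in>ct_class n g.
          ct_class (m + n - 1) (pcomp free_operad m n i f' g'))"
    by (simp add: com_triass_def quot_operad_def ct_class_def)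
  also have "\<dots> = ct_class (m + n - 1) (pcomp free_operad m n i f g)"
  proof (intro UN_ct_class f g ct_class_eqI)
    fix f' g' assume f': "f' \<in> elts free_operad m" "free_eval m f' = free_eval m f"
      and g': "g' \<in> elts free_operad n" "free_eval n g' = free_eval n g"
    show "free_eval (m + n - 1) (pcomp free_operad m n i f' g')
        = free_eval (m + n - 1) (pcomp free_operad m n i f g)"
      unfolding free_eval_pcomp[OF i f'(1) g'(1)] free_eval_pcomp[OF i f g] f'(2) g'(2) ..
  qed (use i f g in \<open>auto intro!: pcomp_free_closed simp del: free_simps atLeastAtMost_iff One_nat_def\<close>)
  finally show ?thesis .
qed

lemma unit_in_free: "Poly_Mapping.single (Leaf 1) 1 \<in> elts free_operad 1"
  by (rule single_elts) (simp add: trees_def)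

lemma ct_opunit: "opunit com_triass = ct_class 1 (Poly_Mapping.single (Leaf 1) 1)"
  by (simp add: com_triass_def quot_operad_def ct_class_def)

lemma bij_betw_ct_eval: "bij_betw (ct_eval n) (elts com_triass n) (elts games n)"
proof (rule bij_betw_imageI)
  show "inj_on (ct_eval n) (elts com_triass n)"
  proof (rule inj_onI)
    fix X Y assume "X \<in> elts com_triass n" "Y \<in> elts com_triass n" and eq: "ct_eval n X = ct_eval n Y"
    then obtain f g where f: "f \<in> elts free_operad n" "X = ct_class n f"
      and g: "g \<in> elts free_operad n" "Y = ct_class n g"
      unfolding elts_com_triass by blast
    show "X = Y"
      using eq unfolding f(2) g(2) ct_eval_class[OF f(1)] ct_eval_class[OF g(1)]
      by (rule ct_class_eqI[OF f(1) g(1)])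
  qed
  show "ct_eval n ` elts com_triass n = elts games n"
  proof (intro equalityI subsetI)
    fix v assume v: "v \<in> elts games n"
    let ?f = "\<Sum>S\<in>coalitions n. Poly_Mapping.single (tree_for n S) (moebius v S)"
    have f: "?f \<in> elts free_operad n"
      by (intro sum_elts single_elts) (use tree_for in auto)
    have "free_eval n ?f = v"
      by (subst (2) game_moebius_expansion[OF v]) (auto simp: free_eval_sum tree_for intro!: sum.cong)
    with f have "v = ct_eval n (ct_class n ?f)" by (simp del: free_simps)
    then show "v \<in> ct_eval n ` elts com_triass n"
      using f unfolding elts_com_triass by blast
  qed (auto simp: elts_com_triass free_eval_closed simp del: free_simps games_simps)
qed

text \<open>The operad axioms of the quotient are obtained here as well, from those of games.\<close>

lemma operad_iso_ct_eval: "operad_iso com_triass games ct_eval"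
proof (rule operad_iso_transport[OF operad_games bij_betw_ct_eval])
  show "\<zero>\<^bsub>component com_triass n\<^esub> \<in> elts com_triass n"
    "ct_eval n \<zero>\<^bsub>component com_triass n\<^esub> = \<zero>\<^bsub>component games n\<^esub>" for n
    using free_closed(3)[of n] by (auto simp: ct_zero elts_com_triass simp del: free_simps)
  show "opunit com_triass \<in> elts com_triass 1"
    using unit_in_free by (auto simp: ct_opunit elts_com_triass simp del: free_simps One_nat_def)
  show "ct_eval 1 (opunit com_triass) = opunit games"
    unfolding ct_opunit ct_eval_class[OF unit_in_free]
    by (auto simp: unanimity_def fun_eq_iff)
next
  fix n x y assume "x \<in> elts com_triass n" "y \<in> elts com_triass n"
  then show "x \<oplus>\<^bsub>component com_triass n\<^esub> y \<in> elts com_triass n"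
    "ct_eval n (x \<oplus>\<^bsub>component com_triass n\<^esub> y) = ct_eval n x \<oplus>\<^bsub>component games n\<^esub> ct_eval n y"
    by (auto simp: elts_com_triass ct_add free_closed simp del: free_simps)
next
  fix n r x assume "x \<in> elts com_triass n"
  then show "r \<odot>\<^bsub>component com_triass n\<^esub> x \<in> elts com_triass n"
    "ct_eval n (r \<odot>\<^bsub>component com_triass n\<^esub> x) = r \<odot>\<^bsub>component games n\<^esub> ct_eval n x"
    by (auto simp: elts_com_triass ct_smult free_closed simp del: free_simps)
next
  fix n \<sigma> x assume "\<sigma> permutes {1..n}" "x \<in> elts com_triass n"
  then show "act com_triass n \<sigma> x \<in> elts com_triass n"
    "ct_eval n (act com_triass n \<sigma> x) = act games n \<sigma> (ct_eval n x)"
    by (auto simp: elts_com_triass ct_act act_free_closed free_eval_act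
        simp del: free_simps games_simps)
next
  fix m n i x y assume "i \<in> {1..m}" "x \<in> elts com_triass m" "y \<in> elts com_triass n"
  then show "pcomp com_triass m n i x y \<in> elts com_triass (m + n - 1)"
    "ct_eval (m + n - 1) (pcomp com_triass m n i x y) = pcomp games m n i (ct_eval m x) (ct_eval n y)"
    by (auto simp: elts_com_triass ct_pcomp pcomp_free_closed free_eval_pcomp
        simp del: free_simps games_simps One_nat_def atLeastAtMost_iff)
qed

section \<open>The basis and the inverse\<close>

lemma free_generators:
  "free_nu \<in> elts free_operad 2" "free_mu \<in> elts free_operad 2"
  unfolding free_nu_def free_mu_def by (auto intro!: single_elts simp: trees_def simp del: free_simps)

lemma generator_games: "dictator_game = unanimity 2 {1}" "bargaining_game = unanimity 2 {1, 2}"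
proof -
  have "{1..2} = {1, 2 :: nat}" by auto
  then show "dictator_game = unanimity 2 {1}" "bargaining_game = unanimity 2 {1, 2}"
    by (auto simp: dictator_game_def bargaining_game_def unanimity_def fun_eq_iff)
qed

lemma ct_generators: "ct_nu = ct_class 2 free_nu" "ct_mu = ct_class 2 free_mu"
  by (simp_all add: ct_nu_def ct_mu_def ct_class_def)

lemma ct_eval_generators: "ct_eval 2 ct_nu = dictator_game" "ct_eval 2 ct_mu = bargaining_game"
  unfolding ct_generators ct_eval_class[OF free_generators(1)] ct_eval_class[OF free_generators(2)]
  by (simp_all add: free_nu_def free_mu_def generator_games insert_commute)

text \<open>An operad morphism with the prescribed values on the generators is determined on the \<open>e\<^sub>S\<close>, since
  these are built from the unit and the generators by composition and permutation of inputs. Stating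
  this for an arbitrary such morphism serves both the computation of the inverse and uniqueness.\<close>

context
  fixes \<psi>
  assumes hom: "operad_hom com_triass games \<psi>"
    and nu: "\<psi> 2 ct_nu = dictator_game" and mu: "\<psi> 2 ct_mu = bargaining_game"
begin

interpretation operad_hom com_triass games \<psi> by (rule hom)

lemma pcomp_closed:
  "\<lbrakk>i \<in> {1..m}; x \<in> elts com_triass m; y \<in> elts com_triass n\<rbrakk> \<Longrightarrow>
    pcomp com_triass m n i x y \<in> elts com_triass (m + n - 1)"
  using dom.pcomp_lin_right unfolding lin_map_def by blast

lemma ct_generators_closed: "ct_nu \<in> elts com_triass 2" "ct_mu \<in> elts com_triass 2"
  using free_generators by (auto simp: ct_generators elts_com_triass simp del: free_simps)

lemma mu_power_value:
  "mu_power (Suc k) \<in> elts com_triass (Suc k) \<and>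
   \<psi> (Suc k) (mu_power (Suc k)) = unanimity (Suc k) {1..Suc k}"
proof (induction k)
  case 0
  have "(\<lambda>S. if S = {1} then 1 else 0) = unanimity 1 {1}"
    by (auto simp: unanimity_def fun_eq_iff)
  then show ?case
    using dom.opunit_closed hom_opunit by simp
next
  case (Suc k)
  have N: "2 + Suc k - 1 = Suc (Suc k)" by simp
  have "(\<Union>j\<in>{1, 2}. if j = 1 then inner_pos 1 ` {1..Suc k} else {outer_pos (Suc k) 1 j})
      = {1..Suc (Suc k)}"
    by (auto simp: inner_pos_def outer_pos_def)
  then have "game_pcomp 2 (Suc k) 1 (unanimity 2 {1, 2}) (unanimity (Suc k) {1..Suc k})
      = unanimity (Suc (Suc k)) {1..Suc (Suc k)}"
    by (subst unanimity_pcomp) (auto simp only: N, auto)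
  then show ?case
    using Suc pcomp_closed[of 1 2 ct_mu "mu_power (Suc k)" "Suc k"]
      hom_pcomp[of 1 2 ct_mu "mu_power (Suc k)" "Suc k"] ct_generators_closed
    unfolding N by (simp add: mu generator_games)
qed

lemma e_initial_value:
  "e_initial (Suc k) d \<in> elts com_triass (Suc k + d) \<and>
   \<psi> (Suc k + d) (e_initial (Suc k) d) = unanimity (Suc k + d) {1..Suc k}"
proof (induction d)
  case 0
  then show ?case using mu_power_value by simp
next
  case (Suc d)
  have N: "2 + (Suc k + d) - 1 = Suc k + Suc d" by simp
  have "(\<Union>j\<in>{1}. if j = 1 then inner_pos 1 ` {1..Suc k} else {outer_pos (Suc k + d) 1 j})
      = {1..Suc k}"
    by (auto simp: inner_pos_def)
  then have "game_pcomp 2 (Suc k + d) 1 (unanimity 2 {1}) (unanimity (Suc k + d) {1..Suc k})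
      = unanimity (Suc k + Suc d) {1..Suc k}"
    by (subst unanimity_pcomp) (auto simp only: N, auto)
  then show ?case
    using Suc pcomp_closed[of 1 2 ct_nu "e_initial (Suc k) d" "Suc k + d"]
      hom_pcomp[of 1 2 ct_nu "e_initial (Suc k) d" "Suc k + d"] ct_generators_closed
    unfolding N by (simp add: nu generator_games)
qed

lemma e_elt_value:
  assumes S: "S \<in> coalitions n"
  shows "e_elt n S \<in> elts com_triass n" "\<psi> n (e_elt n S) = unanimity n S"
proof -
  have fin: "finite S" using S finite_subset by auto
  have "is_unshuffle n S (unshuffle n S)"
    unfolding unshuffle_def by (rule theI'[OF is_unshuffle_ex1]) (use S in blast)
  then have \<sigma>: "unshuffle n S permutes {1..n}" "unshuffle n S ` {1..card S} = S"
    by (auto simp: is_unshuffle_def)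
  obtain k where k: "card S = Suc k"
    using S fin card_gt_0_iff[of S] by (metis (lifting) mem_Collect_eq gr0_implies_Suc)
  have "card S \<le> n" using S card_mono[of "{1..n}" S] by (metis (lifting) card_atLeastAtMost diff_Suc_1 finite_atLeastAtMost mem_Collect_eq)
  then have n: "Suc k + (n - card S) = n" using k by simp
  have e: "e_initial (card S) (n - card S) \<in> elts com_triass n"
    "\<psi> n (e_initial (card S) (n - card S)) = unanimity n {1..card S}"
    using e_initial_value[of k "n - card S", unfolded n] unfolding k by blast+
  show "e_elt n S \<in> elts com_triass n"
    using dom.act_lin[OF \<sigma>(1)] e(1) unfolding e_elt_def lin_map_def by blast
  show "\<psi> n (e_elt n S) = unanimity n S"
    unfolding e_elt_def hom_act[OF \<sigma>(1) e(1)] e(2) unanimity_action[OF \<sigma>(1)] \<sigma>(2) ..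
qed

lemma e_combination_value:
  "\<psi> n (\<Oplus>\<^bsub>component com_triass n\<^esub>S\<in>coalitions n. c S \<odot>\<^bsub>component com_triass n\<^esub> e_elt n S)
    = (\<lambda>R. \<Sum>S\<in>coalitions n. c S * unanimity n S R)"
proof -
  interpret module real_ring "component com_triass n" by (rule dom.vec_space_component)
  have "\<psi> n (\<Oplus>\<^bsub>component com_triass n\<^esub>S\<in>coalitions n. c S \<odot>\<^bsub>component com_triass n\<^esub> e_elt n S)
      = (\<Oplus>\<^bsub>component games n\<^esub>S\<in>coalitions n. \<psi> n (c S \<odot>\<^bsub>component com_triass n\<^esub> e_elt n S))"
    by (rule lin_map_finsum[OF dom.vec_space_component vec_space_games hom_lin finite_coalitions])
      (use e_elt_value in \<open>auto intro!: smult_closed\<close>)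
  also have "\<dots> = (\<lambda>R. \<Sum>S\<in>coalitions n. \<psi> n (c S \<odot>\<^bsub>component com_triass n\<^esub> e_elt n S) R)"
  proof (rule games_finsum[OF finite_coalitions])
    have "\<psi> n x \<in> elts games n" if "x \<in> elts com_triass n" for x
      using hom_lin[of n] that unfolding lin_map_def by blast
    then show "(\<lambda>S. \<psi> n (c S \<odot>\<^bsub>component com_triass n\<^esub> e_elt n S)) \<in> coalitions n \<rightarrow> elts games n"
      using e_elt_value by (auto intro!: smult_closed simp del: games_simps)
  qed
  also have "\<dots> = (\<lambda>R. \<Sum>S\<in>coalitions n. c S * unanimity n S R)"
    using hom_lin[of n] e_elt_value unfolding lin_map_def by (intro ext sum.cong refl) simp
  finally show ?thesis .
qed

end

text \<open>Both sides have the same evaluation, by Moebius inversion on the side of games.\<close>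

lemma com_triass_expansion:
  assumes x: "x \<in> elts com_triass n"
  shows "x = (\<Oplus>\<^bsub>component com_triass n\<^esub>S\<in>coalitions n.
    moebius (ct_eval n x) S \<odot>\<^bsub>component com_triass n\<^esub> e_elt n S)" (is "_ = ?y")
proof -
  interpret iso: operad_iso com_triass games ct_eval by (rule operad_iso_ct_eval)
  interpret module real_ring "component com_triass n" by (rule iso.dom.vec_space_component)
  have "ct_eval n x \<in> elts games n"
    using bij_betw_ct_eval x by (rule bij_betwE[rule_format])
  note hom = iso.operad_hom_axioms ct_eval_generators
  have "ct_eval n ?y = ct_eval n x"
    unfolding e_combination_value[OF hom]
    using game_moebius_expansion[OF \<open>ct_eval n x \<in> elts games n\<close>] by (rule sym)
  moreover have "?y \<in> elts com_triass n"
    using e_elt_value(1)[OF hom] by (intro M.finsum_closed) (auto intro!: smult_closed)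
  ultimately show ?thesis
    using inj_onD[OF bij_betw_imp_inj_on[OF bij_betw_ct_eval], OF sym x] by blast
qed

lemma finite_basis_e_elt: "finite_basis (component com_triass n) (coalitions n) (e_elt n)"
  unfolding finite_basis_def
proof (intro conjI allI impI ballI)
  interpret iso: operad_iso com_triass games ct_eval by (rule operad_iso_ct_eval)
  note hom = iso.operad_hom_axioms ct_eval_generators
  show "e_elt n \<in> coalitions n \<rightarrow> elts com_triass n"
    using e_elt_value(1)[OF hom] by blast
  show "\<exists>c. x = (\<Oplus>\<^bsub>component com_triass n\<^esub>S\<in>coalitions n. c S \<odot>\<^bsub>component com_triass n\<^esub> e_elt n S)"
    if "x \<in> elts com_triass n" for x
    using com_triass_expansion[OF that] by blast
  fix c S
  assume zero: "(\<Oplus>\<^bsub>component com_triass n\<^esub>S\<in>coalitions n. c S \<odot>\<^bsub>component com_triass n\<^esub> e_elt n S)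
      = \<zero>\<^bsub>component com_triass n\<^esub>"
    and S: "S \<in> coalitions n"
  have "ct_eval n \<zero>\<^bsub>component com_triass n\<^esub> = (\<lambda>R. 0)"
    unfolding ct_zero ct_eval_class[OF free_closed(3)] by simp
  then have combination: "(\<lambda>R. \<Sum>S\<in>coalitions n. c S * unanimity n S R) = (\<lambda>R. 0)"
    by (simp only: e_combination_value[OF hom, of n c, unfolded zero])
  show "c S = 0"
    by (rule unanimity_independent[OF fun_cong[OF combination] S])
qed (rule finite_coalitions)

theorem theorem2:
  shows "\<exists>\<phi>. operad_iso com_triass games \<phi> \<and>
           \<phi> 2 ct_nu = dictator_game \<and> \<phi> 2 ct_mu = bargaining_game \<and>
           (\<forall>\<psi>. operad_hom com_triass games \<psi> \<and>
                 \<psi> 2 ct_nu = dictator_game \<and> \<psi> 2 ct_mu = bargaining_game \<longrightarrow>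
                 (\<forall>n. \<forall>x\<in>elts com_triass n. \<psi> n x = \<phi> n x)) \<and>
           (\<forall>n\<ge>1.
              finite_basis (component com_triass n) {S. S \<subseteq> {1..n} \<and> S \<noteq> {}} (e_elt n) \<and>
              (\<forall>v\<in>elts games n.
                 inv_into (elts com_triass n) (\<phi> n) v =
                 (\<Oplus>\<^bsub>component com_triass n\<^esub>S\<in>{S. S \<subseteq> {1..n} \<and> S \<noteq> {}}.
                    moebius v S \<odot>\<^bsub>component com_triass n\<^esub> e_elt n S)))"
proof (intro exI[of _ ct_eval] conjI allI impI ballI)
  interpret iso: operad_iso com_triass games ct_eval by (rule operad_iso_ct_eval)
  show "operad_iso com_triass games ct_eval" by (rule operad_iso_ct_eval)
  show "ct_eval 2 ct_nu = dictator_game" "ct_eval 2 ct_mu = bargaining_game"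
    by (rule ct_eval_generators)+
  show "\<psi> n x = ct_eval n x"
    if "operad_hom com_triass games \<psi> \<and> \<psi> 2 ct_nu = dictator_game \<and> \<psi> 2 ct_mu = bargaining_game"
      and x: "x \<in> elts com_triass n" for \<psi> n x
  proof -
    have \<psi>: "operad_hom com_triass games \<psi>" "\<psi> 2 ct_nu = dictator_game" "\<psi> 2 ct_mu = bargaining_game"
      using that by auto
    define c where "c = moebius (ct_eval n x)"
    have x: "x = (\<Oplus>\<^bsub>component com_triass n\<^esub>S\<in>coalitions n. c S \<odot>\<^bsub>component com_triass n\<^esub> e_elt n S)"
      unfolding c_def by (rule com_triass_expansion[OF x])
    show ?thesis
      unfolding x e_combination_value[OF \<psi>]
        e_combination_value[OF iso.operad_hom_axioms ct_eval_generators] ..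
  qed
  show "finite_basis (component com_triass n) (coalitions n) (e_elt n)" for n
    by (rule finite_basis_e_elt)
  show "inv_into (elts com_triass n) (ct_eval n) v =
      (\<Oplus>\<^bsub>component com_triass n\<^esub>S\<in>coalitions n. moebius v S \<odot>\<^bsub>component com_triass n\<^esub> e_elt n S)"
    if v: "v \<in> elts games n" for n v
  proof -
    obtain x where x: "x \<in> elts com_triass n" "v = ct_eval n x"
      using bij_betw_imp_surj_on[OF bij_betw_ct_eval[of n]] v by blast
    then have "inv_into (elts com_triass n) (ct_eval n) v = x"
      using bij_betw_imp_inj_on[OF bij_betw_ct_eval] by (simp add: inv_into_f_f)
    also have "\<dots> = (\<Oplus>\<^bsub>component com_triass n\<^esub>S\<in>coalitions n.
        moebius v S \<odot>\<^bsub>component com_triass n\<^esub> e_elt n S)"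
      using com_triass_expansion[OF x(1)] unfolding x(2) .
    finally show ?thesis .
  qed
qed

end
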